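(* Let $q=p^n$, where $p$ is a prime and $n$ is a positive integer, and let $X$ be an extremal Peisert-type graph defined over $\mathbb{F}_{q^2}$. (1) If $n=1$ and $p\ge 3$, then $X$ is of type $(\frac{p+3}{2},p)$, and $X$ is unique up to isomorphism (any two extremal Peisert-type graphs defined over $\mathbb{F}_{p^2}$ are isomorphic). (2) If $n>1$, then $X$ is of type $(p^{n-k}+1,q)$, where $k$ is the largest proper divisor of $n$.
   Context: Let $q$ be a prime power. For an abelian group $G$ and $S\subseteq G\setminus\{0\}$ with $S=-S$, $\operatorname{Cay}(G,S)$ is the graph with vertex set $G$ in which $g\sim h$ iff $g-h\in S$. A Peisert-type graph of type $(m,q)$ (also called a Peisert-type graph defined over $\mathbb{F}_{q^2}$) is a graph $\operatorname{Cay}(\mathbb{F}_{q^2}^+,S)$ where $S=c_1\mathbb{F}_q^*\cup\cdots\cup c_m\mathbb{F}_q^*$ is a union of $m\le q$ distinct cosets of $\mathbb{F}_q^*$ in $\mathbb{F}_{q^2}^*$. Such a graph has clique number $q$; a maximum clique is a clique of size $q$. The canonical cliques are the sets $x+c_i\mathbb{F}_q$ with $x\in\mathbb{F}_{q^2}$, $1\le i\le m$. The graph has the strict-EKR property if every maximum clique is canonical. A Peisert-type graph of type $(m,q)$ is extremal if it does not have the strict-EKR property while every Peisert-type graph of type $(m-1,q)$ has the strict-EKR property. *)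

theory Defs
  imports
    "HOL-Library.Cardinality"
    "HOL-Computational_Algebra.Primes"
    "Graph_Theory.Graph_Theory"
begin

text \<open>
  The field of order \<open>q\<^sup>2\<close> is a type \<open>'a :: {field, finite}\<close>, and its subfield of order \<open>q\<close> is a
  parameter \<open>K :: 'a set\<close>. A finite field has at most one subfield of a given order, so \<open>K\<close> is
  determined by its cardinality. An undirected graph is a symmetric loop-free digraph, as in the
  locale \<^locale>\<open>graph\<close>.
\<close>

definition is_subfield :: "'a::field set \<Rightarrow> bool" where
  "is_subfield K \<longleftrightarrow> 0 \<in> K \<and> 1 \<in> K \<and>
     (\<forall>x\<in>K. \<forall>y\<in>K. x + y \<in> K \<and> x * y \<in> K) \<and>
     (\<forall>x\<in>K. - x \<in> K \<and> inverse x \<in> K)"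

definition Cay :: "'a::ab_group_add set \<Rightarrow> ('a, 'a \<times> 'a) pre_digraph" where
  "Cay S = with_proj \<lparr> pverts = UNIV, parcs = {(g, h). g - h \<in> S} \<rparr>"

definition is_clique :: "('a, 'b) pre_digraph \<Rightarrow> 'a set \<Rightarrow> bool" where
  "is_clique G C \<longleftrightarrow> C \<subseteq> verts G \<and> pairwise (\<lambda>u v. u \<rightarrow>\<^bsub>G\<^esub> v) C"

definition unit_coset :: "'a::field set \<Rightarrow> 'a \<Rightarrow> 'a set" where
  "unit_coset K c = (\<lambda>k. c * k) ` (K - {0})"

text \<open>
  A Peisert-type graph is given by the set \<open>D\<close> of the \<open>m\<close> distinct cosets whose union is its
  connection set; the connection set determines \<open>D\<close>, since distinct cosets are disjoint.
\<close>

definition coset_family :: "'a::field set \<Rightarrow> nat \<Rightarrow> 'a set set \<Rightarrow> bool" where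
  "coset_family K m D \<longleftrightarrow>
     D \<subseteq> unit_coset K ` (UNIV - {0}) \<and> card D = m \<and> 1 \<le> m \<and> m \<le> card K"

definition peisert_type ::
    "'a::field set \<Rightarrow> nat \<Rightarrow> ('a, 'a \<times> 'a) pre_digraph \<Rightarrow> bool" where
  "peisert_type K m X \<longleftrightarrow> (\<exists>D. coset_family K m D \<and> X = Cay (\<Union>D))"

definition canonical_clique :: "'a::field set \<Rightarrow> 'a set set \<Rightarrow> 'a set \<Rightarrow> bool" where
  "canonical_clique K D C \<longleftrightarrow>
     (\<exists>x c. c \<noteq> 0 \<and> unit_coset K c \<in> D \<and> C = (\<lambda>k. x + c * k) ` K)"

text \<open>The clique number is \<open>card K\<close>, so the maximum cliques are the cliques of that size.\<close>

definition strict_EKR :: "'a::field set \<Rightarrow> 'a set set \<Rightarrow> bool" where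
  "strict_EKR K D \<longleftrightarrow>
     (\<forall>C. is_clique (Cay (\<Union>D)) C \<and> card C = card K \<longrightarrow> canonical_clique K D C)"

text \<open>For \<open>m = 1\<close> there is no graph of type \<open>m - 1\<close>, and the last condition is vacuous.\<close>

definition extremal_peisert ::
    "'a::field set \<Rightarrow> ('a, 'a \<times> 'a) pre_digraph \<Rightarrow> bool" where
  "extremal_peisert K X \<longleftrightarrow>
     (\<exists>m D. coset_family K m D \<and> X = Cay (\<Union>D) \<and> \<not> strict_EKR K D \<and>
        (\<forall>D'. coset_family K (m - 1) D' \<longrightarrow> strict_EKR K D'))"

lemma coset_family_connection_set:
  assumes "is_subfield K" "coset_family K m D"
  shows "0 \<notin> \<Union>D" and "uminus ` \<Union>D = \<Union>D"
proof -
  have cosets: "\<exists>c. c \<noteq> 0 \<and> B = unit_coset K c" if "B \<in> D" for B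
    using assms(2) that by (auto simp: coset_family_def)
  show "0 \<notin> \<Union>D"
  proof
    assume "0 \<in> \<Union>D"
    then obtain B where "B \<in> D" "0 \<in> B" by blast
    with cosets show False by (fastforce simp: unit_coset_def)
  qed
  have neg: "- x \<in> \<Union>D" if x: "x \<in> \<Union>D" for x
  proof -
    obtain B where B: "B \<in> D" "x \<in> B" using x by blast
    then obtain c where c: "B = unit_coset K c" using cosets by blast
    then obtain k where k: "k \<in> K" "k \<noteq> 0" "x = c * k"
      using B(2) by (auto simp: unit_coset_def)
    have "- k \<in> K - {0}" using k assms(1) by (auto simp: is_subfield_def)
    then have "c * - k \<in> B" unfolding c unit_coset_def by (rule imageI)
    then show ?thesis using B k by auto
  qed
  show "uminus ` \<Union>D = \<Union>D"
  proof
    show "uminus ` \<Union>D \<subseteq> \<Union>D" using neg by blast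
    show "\<Union>D \<subseteq> uminus ` \<Union>D"
    proof
      fix x assume "x \<in> \<Union>D"
      then have "- (- x) \<in> uminus ` \<Union>D" by (intro imageI neg)
      then show "x \<in> uminus ` \<Union>D" by simp
    qed
  qed
qed

end

theory Submission
  imports Defs "HOL-Computational_Algebra.Polynomial"
begin

text \<open>
  If \<open>m \<le> q\<close>, some coset \<open>w K\<^sup>*\<close> is not used, and in a basis \<open>v, w\<close> a clique of size \<open>q\<close> is the
  graph of a function \<open>f : K \<rightarrow> K\<close> whose difference quotients (slopes) \<open>s\<close> give used cosets of
  \<open>v + s w\<close>; it is canonical iff \<open>f\<close> is affine. The type of an extremal graph is therefore the least
  number \<open>N\<close> of slopes of a non-affine function, and this is a problem about the polynomial
  \<open>R(X, Y) = \<Prod>\<^sub>x (X + x Y - f x)\<close>.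

  For \<open>n > 1\<close>, suppose \<open>2 N \<le> q\<close>. Redei's lacunary polynomial argument shows that each line whose
  slope is a slope of \<open>f\<close> meets the graph in \<open>0\<close> modulo \<open>p\<close> points. Hence \<open>\<partial>R/\<partial>X\<close> does not depend on
  \<open>X\<close>, and comparing vanishing orders shows that all lines of a given slope that meet the graph meet it
  in the same number of points, a power of \<open>p\<close>. Let \<open>s = p\<^sup>e\<close> be the least of these numbers. For a slope
  attaining it, \<open>R\<close> specialises to the \<open>s\<close>-th power of a squarefree polynomial, which gives
  \<open>N \<ge> q/s\<close>, and \<open>N \<equiv> 1\<close> modulo \<open>p\<close> sharpens this to \<open>q/s + 1\<close>. The lowest-order part of \<open>R\<close> at such a
  line has the shape \<open>c\<^sub>0 + c\<^sub>1 t + c\<^sub>2 t\<^sup>s\<close> with \<open>s\<close> distinct roots, so that \<open>K\<close> contains \<open>s\<close> solutions of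
  \<open>w\<^sup>s = w\<close>; this forces \<open>e\<close> to divide \<open>n\<close>. The trace onto the largest proper subfield attains the bound.

  For \<open>n = 1\<close>, the sums \<open>\<Sum>\<^sub>x x\<^sup>i f(x)\<^sup>j\<close> with \<open>i + j \<le> p - N\<close> vanish, which (following Lovasz and
  Schrijver) bounds the degree of \<open>f\<close> and, if \<open>2 N = p + 3\<close>, forces
  \<open>f(x) = c (x - x\<^sub>0)\<^bsup>(p+1)/2\<^esup> + b x + b'\<close>. The slope set is then unique up to an affine map, hence the
  graph up to a \<open>K\<close>-linear change of basis.
\<close>

section \<open>Directions determined by the graph of a function\<close>

definition slopes :: "'a::field set \<Rightarrow> ('a \<Rightarrow> 'a) \<Rightarrow> 'a set" where
  "slopes K f = {(f x - f y) / (x - y) | x y. x \<in> K \<and> y \<in> K \<and> x \<noteq> y}"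

text \<open>\<open>a\<close> and \<open>b\<close> range over the ambient field; when
  \<open>f\<close> maps \<open>K\<close> into itself they equal \<open>f 1 - f 0\<close> and
  \<open>f 0\<close>, hence lie in \<open>K\<close>.\<close>

definition affine_fun :: "'a::field set \<Rightarrow> ('a \<Rightarrow> 'a) \<Rightarrow> bool" where
  "affine_fun K f \<longleftrightarrow> (\<exists>a b. \<forall>x\<in>K. f x = a * x + b)"

lemma slopesI: "x \<in> K \<Longrightarrow> y \<in> K \<Longrightarrow> x \<noteq> y \<Longrightarrow> (f x - f y) / (x - y) \<in> slopes K f"
  by (auto simp: slopes_def)

lemma slopes_eq_image:
  "slopes K f = (\<lambda>(x, y). (f x - f y) / (x - y)) ` {(x, y). x \<in> K \<and> y \<in> K \<and> x \<noteq> y}"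
  by (auto simp: slopes_def)

lemma slopes_add_linear: "slopes K (\<lambda>x. f x + b * x + c) = (\<lambda>s. s + b) ` slopes K f"
  unfolding slopes_eq_image image_image
  by (intro image_cong refl) (auto simp: field_simps)

section \<open>Products of linear factors\<close>

text \<open>Each factor has total degree at most 1 in the two variables, so the product has total
  degree at most \<open>card A\<close>. Truncated subtraction would hide the vanishing above
  \<open>card A\<close>, which is therefore stated separately.\<close>

lemma coeff_prod_linear:
  fixes c :: "'b \<Rightarrow> 'a::comm_ring_1 poly"
  assumes "finite A" "\<And>x. x \<in> A \<Longrightarrow> degree (c x) \<le> 1"
  shows "(i > card A \<longrightarrow> coeff (\<Prod>x\<in>A. [:c x, 1:]) i = 0) \<and>
    degree (coeff (\<Prod>x\<in>A. [:c x, 1:]) i) \<le> card A - i"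
  using assms
proof (induction A arbitrary: i rule: finite_induct)
  case empty
  then show ?case by simp
next
  case (insert x A)
  let ?P = "\<Prod>x\<in>A. [:c x, 1:]"
  have rec: "coeff (\<Prod>x\<in>insert x A. [:c x, 1:]) i
      = c x * coeff ?P i + (case i of 0 \<Rightarrow> 0 | Suc j \<Rightarrow> coeff ?P j)"
    using insert by (simp add: coeff_pCons split: nat.split)
  have IH: "(j > card A \<longrightarrow> coeff ?P j = 0) \<and> degree (coeff ?P j) \<le> card A - j" for j
    using insert by auto
  have d1: "degree (c x * coeff ?P i) \<le> Suc (card A) - i"
  proof (cases "i > card A")
    case False
    have "degree (c x * coeff ?P i) \<le> 1 + (card A - i)"
      using insert.prems[of x] IH[of i] by (intro order_trans[OF degree_mult_le] add_mono) auto
    then show ?thesis using False by linarith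
  qed (use IH in simp)
  have d2: "degree (case i of 0 \<Rightarrow> 0 | Suc j \<Rightarrow> coeff ?P j) \<le> Suc (card A) - i"
    using IH by (auto split: nat.split)
  show ?case
    unfolding rec using insert.hyps IH[of i] IH[of "i - 1"] degree_add_le[OF d1 d2]
    by (auto split: nat.split)
qed

lemma map_poly_poly_prod_linear:
  fixes c :: "'b \<Rightarrow> 'a::comm_ring_1 poly"
  shows "map_poly (\<lambda>r. poly r y) (\<Prod>x\<in>A. [:c x, 1:]) = (\<Prod>x\<in>A. [:poly (c x) y, 1:])"
proof -
  have mult: "map_poly (\<lambda>r. poly r y) (P * Q) = map_poly (\<lambda>r. poly r y) P * map_poly (\<lambda>r. poly r y) Q"
    for P Q :: "'a poly poly"
    by (intro poly_eqI) (simp add: coeff_map_poly coeff_mult poly_sum)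
  show ?thesis
    by (induction A rule: infinite_finite_induct) (simp_all add: mult map_poly_pCons del: mult_pCons_left)
qed

lemma prod_linear_eq_prod_fiber:
  fixes f :: "'b \<Rightarrow> 'a::comm_ring_1"
  assumes "finite A"
  shows "(\<Prod>x\<in>A. [:- f x, 1:]) = (\<Prod>a\<in>f ` A. [:- a, 1:] ^ card {x\<in>A. f x = a})"
proof -
  have "(\<Prod>x\<in>A. [:- f x, 1:]) = (\<Prod>a\<in>f ` A. \<Prod>x\<in>{x\<in>A. f x = a}. [:- f x, 1:])"
    using prod.image_gen[OF assms, of "\<lambda>x. [:- f x, 1:]" f] by simp
  also have "\<dots> = (\<Prod>a\<in>f ` A. [:- a, 1:] ^ card {x\<in>A. f x = a})"
    by (intro prod.cong refl) simp
  finally show ?thesis .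
qed

text \<open>In each summand of the product rule only one factor is differentiated, and it loses at
  most one power.\<close>

lemma prod_linear_power_dvd_pderiv:
  fixes m :: "'a::idom \<Rightarrow> nat"
  assumes "finite A"
  shows "(\<Prod>a\<in>A. [:- a, 1:] ^ (m a - 1)) dvd pderiv (\<Prod>a\<in>A. [:- a, 1:] ^ m a)"
  unfolding pderiv_prod
proof (rule dvd_sum)
  fix a assume a: "a \<in> A"
  have "[:- a, 1:] ^ (m a - 1) dvd pderiv ([:- a, 1:] ^ m a)"
    by (cases "m a") (simp_all add: pderiv_power_Suc dvd_smult pderiv_pCons del: power_Suc)
  moreover have "(\<Prod>b\<in>A - {a}. [:- b, 1:] ^ (m b - 1)) dvd (\<Prod>b\<in>A - {a}. [:- b, 1:] ^ m b)"
    by (intro prod_dvd_prod le_imp_power_dvd) simp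
  ultimately show "(\<Prod>a\<in>A. [:- a, 1:] ^ (m a - 1)) dvd
      (\<Prod>b\<in>A - {a}. [:- b, 1:] ^ m b) * pderiv ([:- a, 1:] ^ m a)"
    using assms a by (simp add: prod.remove[of A a] mult_dvd_mono mult.commute)
qed

lemma order_linear_power_mult:
  fixes Q :: "'a::idom poly"
  assumes "poly Q a \<noteq> 0" shows "order a ([:- a, 1:] ^ k * Q) = k"
proof -
  have "Q \<noteq> 0" using assms by auto
  then have "[:- a, 1:] ^ k * Q \<noteq> 0" by simp
  then show ?thesis
    using assms by (simp add: order_mult order_power_n_n order_0I)
qed

section \<open>Subfields of order a power of the characteristic\<close>

text \<open>Polynomials have coefficients in the ambient field, whose order is left open here; only
  its characteristic and the order of \<open>K\<close> are fixed.\<close>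

locale char_subfield =
  fixes K :: "'a::{field,finite} set" and p n :: nat
  assumes subfield: "is_subfield K" and prime: "prime p" and char: "CHAR('a) = p"
    and card_K: "card K = p ^ n"
begin

lemma zero_mem [simp]: "0 \<in> K" and one_mem [simp]: "1 \<in> K"
  and add_mem [simp]: "x \<in> K \<Longrightarrow> y \<in> K \<Longrightarrow> x + y \<in> K"
  and mult_mem [simp]: "x \<in> K \<Longrightarrow> y \<in> K \<Longrightarrow> x * y \<in> K"
  and uminus_mem [simp]: "x \<in> K \<Longrightarrow> - x \<in> K"
  and inverse_mem [simp]: "x \<in> K \<Longrightarrow> inverse x \<in> K"
  using subfield by (auto simp: is_subfield_def)

lemma diff_mem [simp]: "x \<in> K \<Longrightarrow> y \<in> K \<Longrightarrow> x - y \<in> K"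
  using add_mem[of x "- y"] by simp

lemma divide_mem [simp]: "x \<in> K \<Longrightarrow> y \<in> K \<Longrightarrow> x / y \<in> K"
  by (simp add: divide_inverse)

lemma power_mem [simp]: "x \<in> K \<Longrightarrow> x ^ k \<in> K"
  by (induction k) auto

lemma sum_mem: "(\<And>i. i \<in> A \<Longrightarrow> f i \<in> K) \<Longrightarrow> sum f A \<in> K"
  by (induction A rule: infinite_finite_induct) auto

lemma of_nat_mem [simp]: "of_nat k \<in> K"
  by (induction k) auto

lemma slopes_subset:
  assumes "f ` K \<subseteq> K" shows "slopes K f \<subseteq> K"
  using assms by (auto simp: slopes_def image_subset_iff)

lemma card_K_ge_2: "p ^ n \<ge> 2"
proof -
  have "card {0, 1 :: 'a} \<le> card K" by (intro card_mono) auto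
  then show ?thesis by (simp add: card_K)
qed

lemma n_pos: "n > 0"
  using card_K_ge_2 by (cases n) auto

lemma p_gt_1: "p > 1"
  using prime prime_gt_1_nat by blast

lemma of_nat_p [simp]: "of_nat p = (0 :: 'a)"
  using char of_nat_CHAR by metis

lemma of_nat_eq_0_iff_dvd: "of_nat k = (0 :: 'a) \<longleftrightarrow> p dvd k"
  using char of_nat_eq_0_iff_char_dvd by metis

lemma of_nat_card_K: "of_nat (p ^ n) = (0 :: 'a)"
  using n_pos by (simp add: power_0_left)

lemma frobenius_add: "(x + y :: 'a) ^ (p ^ e) = x ^ (p ^ e) + y ^ (p ^ e)"
  using freshmans_dream'[of "p ^ e" e x y] prime char by simp

lemma frobenius_uminus: "(- x :: 'a) ^ (p ^ e) = - (x ^ (p ^ e))"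
proof -
  have "(- x + x) ^ (p ^ e) = (- x) ^ (p ^ e) + x ^ (p ^ e)" by (rule frobenius_add)
  moreover have "(- x + x) ^ (p ^ e) = 0" using p_gt_1 by simp
  ultimately show ?thesis by (simp add: eq_neg_iff_add_eq_0)
qed

lemma frobenius_diff: "(x - y :: 'a) ^ (p ^ e) = x ^ (p ^ e) - y ^ (p ^ e)"
  using frobenius_add[of x "- y" e] by (simp add: frobenius_uminus)

lemma bij_betw_mult:
  assumes "c \<in> K" "c \<noteq> 0" shows "bij_betw (\<lambda>x. c * x) K K"
proof (rule bij_betw_byWitness[where f' = "\<lambda>x. inverse c * x"])
qed (use assms in auto)

text \<open>Multiplication by \<open>x\<close> permutes the nonzero elements of \<open>K\<close>, so
  their product does not change when every factor is multiplied by \<open>x\<close>.\<close>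

lemma power_card_minus_1:
  assumes "x \<in> K" "x \<noteq> 0" shows "x ^ (p ^ n - 1) = 1"
proof -
  have "bij_betw (\<lambda>k. x * k) (K - {0}) (K - {0})"
    by (rule bij_betw_byWitness[where f' = "\<lambda>k. inverse x * k"]) (use assms in auto)
  then have "(\<Prod>k\<in>K - {0}. k) = (\<Prod>k\<in>K - {0}. x * k)"
    using prod.reindex_bij_betw[of "\<lambda>k. x * k" _ _ "\<lambda>k. k"] by metis
  also have "\<dots> = x ^ card (K - {0}) * (\<Prod>k\<in>K - {0}. k)"
    by (simp add: prod.distrib)
  finally have "x ^ card (K - {0}) = 1" by (simp add: prod_zero_iff)
  then show ?thesis by (simp add: card_K)
qed

lemma power_card: "x \<in> K \<Longrightarrow> x ^ (p ^ n) = x"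
  using power_card_minus_1[of x] card_K_ge_2 p_gt_1
  by (cases "x = 0") (auto simp: power_eq_if[of x "p ^ n"] simp del: One_nat_def)

lemma prod_linear_factors:
  "(\<Prod>k\<in>K. [:- k, 1:]) = monom 1 (p ^ n) - monom 1 1"
proof (rule poly_eqI_degree_lead_coeff[where n = "p ^ n" and A = K])
  have deg: "degree (\<Prod>k\<in>K. [:- k, 1:]) = p ^ n"
    by (subst degree_prod_sum_eq) (auto simp: card_K)
  then show "degree (\<Prod>k\<in>K. [:- k, 1:]) \<le> p ^ n" by simp
  have "lead_coeff (\<Prod>k\<in>K. [:- k, 1:]) = 1"
    by (simp add: lead_coeff_prod)
  then show "coeff (\<Prod>k\<in>K. [:- k, 1:]) (p ^ n) = coeff (monom 1 (p ^ n) - monom 1 1) (p ^ n)"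
    using deg card_K_ge_2 by simp
  show "degree (monom (1::'a) (p ^ n) - monom 1 1) \<le> p ^ n"
    using card_K_ge_2 by (intro degree_diff_le) (auto simp: degree_monom_eq)
next
  fix z assume "z \<in> K"
  then have "poly (\<Prod>k\<in>K. [:- k, 1:]) z = 0"
    by (simp add: poly_prod prod_zero_iff)
  then show "poly (\<Prod>k\<in>K. [:- k, 1:]) z = poly (monom 1 (p ^ n) - monom 1 1) z"
    using \<open>z \<in> K\<close> by (simp add: poly_monom power_card)
qed (simp add: card_K)

text \<open>\<open>X^k - 1\<close> has too few roots to vanish on all nonzero elements. If
  \<open>g ^ k \<noteq> 1\<close>, substituting \<open>g * x\<close> for \<open>x\<close> multiplies
  the sum by \<open>g ^ k\<close>, so it is 0. For \<open>k = 0\<close> each term is 1, also at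
  \<open>x = 0\<close>, and the sum is \<open>q = 0\<close>.\<close>

lemma power_sum_eq_0:
  assumes "k < p ^ n - 1" shows "(\<Sum>x\<in>K. x ^ k) = 0"
proof (cases "k = 0")
  case True
  then show ?thesis by (simp add: card_K n_pos)
next
  case False
  have "\<exists>g\<in>K - {0}. g ^ k \<noteq> 1"
  proof (rule ccontr)
    assume "\<not> ?thesis"
    then have sub: "K - {0} \<subseteq> {x. poly (monom 1 k - 1) x = 0}" by (auto simp: poly_monom)
    have nz: "monom 1 k - 1 \<noteq> (0 :: 'a poly)"
    proof
      assume "monom 1 k - 1 = (0 :: 'a poly)"
      then have "coeff (monom 1 k - 1) 0 = (0 :: 'a)" by simp
      with False show False by simp
    qed
    have "card (K - {0}) \<le> card {x. poly (monom 1 k - 1 :: 'a poly) x = 0}"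
      by (intro card_mono sub) simp
    also have "\<dots> \<le> degree (monom 1 k - 1 :: 'a poly)"
      by (rule card_poly_roots_bound[OF nz])
    also have "\<dots> \<le> k" by (intro degree_diff_le) (auto simp: degree_monom_eq)
    finally show False using assms by (simp add: card_K)
  qed
  then obtain g where g: "g \<in> K" "g \<noteq> 0" "g ^ k \<noteq> 1" by auto
  have "(\<Sum>x\<in>K. x ^ k) = (\<Sum>x\<in>K. (g * x) ^ k)"
    using sum.reindex_bij_betw[OF bij_betw_mult[OF g(1,2)], of "\<lambda>x. x ^ k"] by simp
  also have "\<dots> = g ^ k * (\<Sum>x\<in>K. x ^ k)"
    by (simp add: power_mult_distrib sum_distrib_left)
  finally show ?thesis using g(3) by simp
qed

lemma power_sum_card_minus_1: "(\<Sum>x\<in>K. x ^ (p ^ n - 1)) = -1"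
proof -
  have "(\<Sum>x\<in>K. x ^ (p ^ n - 1)) = (\<Sum>x\<in>K. if x = 0 then 0 else 1)"
    using card_K_ge_2 by (intro sum.cong) (auto simp: power_card_minus_1 power_0_left simp del: One_nat_def)
  also have "\<dots> = of_nat (card (K - {0}))"
    by (simp add: sum.If_cases Diff_eq)
  also have "\<dots> = of_nat (p ^ n) - 1"
    using card_K_ge_2 by (simp only: card_K card_Diff_singleton zero_mem of_nat_diff of_nat_1)
  finally show ?thesis by (simp add: n_pos)
qed

lemma power_sum_above:
  assumes "p ^ n - 1 < k" "k < 2 * (p ^ n - 1)" shows "(\<Sum>x\<in>K. x ^ k) = 0"
proof -
  define r where "r = k - (p ^ n - 1)"
  have r: "0 < r" "r < p ^ n - 1" "k = (p ^ n - 1) + r" using assms by (auto simp: r_def)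
  \<comment> \<open>Since \<open>r > 0\<close>, lowering the exponent by \<open>p ^ n - 1\<close> is
    also correct at \<open>x = 0\<close>.\<close>
  have "(\<Sum>x\<in>K. x ^ k) = (\<Sum>x\<in>K. x ^ r)"
  proof (intro sum.cong refl)
    fix x assume "x \<in> K"
    then show "x ^ k = x ^ r"
      using r(1) unfolding r(3) power_add
      by (cases "x = 0") (simp_all add: power_card_minus_1 power_0_left del: One_nat_def)
  qed
  then show ?thesis using power_sum_eq_0[OF r(2)] by simp
qed

text \<open>Below exponent \<open>2 * (p ^ n - 1)\<close> the only nonzero power sum is that of
  \<open>p ^ n - 1\<close>, with value -1.\<close>

lemma sum_poly:
  assumes "degree P < 2 * (p ^ n - 1)"
  shows "(\<Sum>x\<in>K. poly P x) = - coeff P (p ^ n - 1)"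
proof -
  define d where "d = 2 * (p ^ n - 1)"
  have "(\<Sum>x\<in>K. poly P x) = (\<Sum>x\<in>K. \<Sum>i<d. coeff P i * x ^ i)"
    using assms by (intro sum.cong refl) (simp add: poly_altdef d_def, intro sum.mono_neutral_left, auto simp: coeff_eq_0)
  also have "\<dots> = (\<Sum>i<d. coeff P i * (\<Sum>x\<in>K. x ^ i))"
    by (subst sum.swap) (simp add: sum_distrib_left)
  also have "\<dots> = (\<Sum>i\<in>{p ^ n - 1}. coeff P i * (\<Sum>x\<in>K. x ^ i))"
  proof (rule sum.mono_neutral_right)
    show "{p ^ n - 1} \<subseteq> {..<d}" using card_K_ge_2 by (auto simp: d_def)
    show "\<forall>i\<in>{..<d} - {p ^ n - 1}. coeff P i * (\<Sum>x\<in>K. x ^ i) = 0"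
    proof
      fix i assume i: "i \<in> {..<d} - {p ^ n - 1}"
      then consider "i < p ^ n - 1" | "p ^ n - 1 < i" "i < 2 * (p ^ n - 1)"
        by (force simp: d_def)
      then have "(\<Sum>x\<in>K. x ^ i) = 0" by cases (auto simp: power_sum_eq_0 power_sum_above)
      then show "coeff P i * (\<Sum>x\<in>K. x ^ i) = 0" by simp
    qed
  qed simp
  finally show ?thesis by (simp add: power_sum_card_minus_1 del: One_nat_def)
qed

lemma interpolate:
  obtains P where "degree P < p ^ n" "\<And>x. x \<in> K \<Longrightarrow> poly P x = f x"
proof
  \<comment> \<open>On \<open>K\<close>, \<open>1 - (X - a)^(q-1)\<close> is the indicator function
    of \<open>a\<close>.\<close>
  define P where "P = (\<Sum>a\<in>K. smult (f a) (1 - [:- a, 1:] ^ (p ^ n - 1)))"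
  have "degree P \<le> p ^ n - 1"
    unfolding P_def
    by (intro degree_sum_le order_trans[OF degree_smult_le] degree_diff_le)
      (auto simp: degree_linear_power)
  then show "degree P < p ^ n" using card_K_ge_2 by linarith
  fix x assume x: "x \<in> K"
  have "poly (smult (f a) (1 - [:- a, 1:] ^ (p ^ n - 1))) x = (if a = x then f a else 0)"
    if "a \<in> K" for a
    using that x card_K_ge_2 power_card_minus_1[of "x - a"] by (auto simp: power_0_left)
  then have "poly P x = (\<Sum>a\<in>K. if a = x then f a else 0)"
    unfolding P_def poly_sum by (intro sum.cong) auto
  then show "poly P x = f x" using x by simp
qed

section \<open>The Redei polynomial of a function\<close>

text \<open>The outer variable is \<open>X\<close> and the variable of the coefficients is \<open>Y\<close>.\<close>

definition redei :: "('a \<Rightarrow> 'a) \<Rightarrow> 'a poly poly" where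
  "redei f = (\<Prod>x\<in>K. [:[:- f x, x:], 1:])"

lemma degree_coeff_redei: "degree (coeff (redei f) i) \<le> p ^ n - i"
  and coeff_redei_above: "i > p ^ n \<Longrightarrow> coeff (redei f) i = 0"
  using coeff_prod_linear[of K "\<lambda>x. [:- f x, x:]" i] by (auto simp: redei_def card_K)

lemma eval_redei: "map_poly (\<lambda>r. poly r y) (redei f) = (\<Prod>x\<in>K. [:- (f x - y * x), 1:])"
  unfolding redei_def map_poly_poly_prod_linear by (simp add: algebra_simps)

lemma poly_coeff_redei:
  "poly (coeff (redei f) i) y = coeff (\<Prod>x\<in>K. [:- (f x - y * x), 1:]) i"
  unfolding eval_redei[symmetric] by (simp add: coeff_map_poly)

text \<open>A collision would put two points of the graph on a line of slope \<open>y\<close>;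
  finiteness turns injectivity into bijectivity.\<close>

lemma bij_betw_non_slope:
  assumes f: "f ` K \<subseteq> K" and y: "y \<in> K - slopes K f"
  shows "bij_betw (\<lambda>x. f x - y * x) K K"
proof -
  have inj: "inj_on (\<lambda>x. f x - y * x) K"
  proof (rule inj_onI, rule ccontr)
    fix x x' assume x: "x \<in> K" "x' \<in> K" "f x - y * x = f x' - y * x'" "x \<noteq> x'"
    then have "(f x - f x') / (x - x') = y" by (simp add: field_simps)
    with slopesI[of x K x' f] x y show False by auto
  qed
  moreover have "(\<lambda>x. f x - y * x) ` K = K"
    using f y by (intro endo_inj_surj inj) auto
  ultimately show ?thesis by (simp add: bij_betw_def)
qed

lemma prod_linear_non_slope:
  assumes "f ` K \<subseteq> K" "y \<in> K - slopes K f"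
  shows "(\<Prod>x\<in>K. [:- (f x - y * x), 1:]) = monom 1 (p ^ n) - monom 1 1"
  using prod.reindex_bij_betw[OF bij_betw_non_slope[OF assms], of "\<lambda>k. [:- k, 1:]"]
  by (simp only: prod_linear_factors)

text \<open>The coefficient has degree at most \<open>q - i < q - N\<close> in \<open>Y\<close>, but
  vanishes at all \<open>q - N\<close> non-slopes, where \<open>R\<close> specialises to
  \<open>X^q - X\<close>.\<close>

lemma coeff_redei_eq_0:
  assumes f: "f ` K \<subseteq> K" and i: "1 < i" "card (slopes K f) < i" "i < p ^ n"
  shows "coeff (redei f) i = 0"
proof (rule poly_eqI_degree[where A = "K - slopes K f"])
  fix y assume "y \<in> K - slopes K f"
  then show "poly (coeff (redei f) i) y = poly 0 y"
    using i by (simp add: poly_coeff_redei prod_linear_non_slope[OF f] del: minus_diff_eq)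
next
  have "card (K - slopes K f) = p ^ n - card (slopes K f)"
    by (simp add: card_Diff_subset slopes_subset[OF f] card_K)
  then show "degree (coeff (redei f) i) < card (K - slopes K f)"
    and "degree 0 < card (K - slopes K f)"
    using degree_coeff_redei[of f i] i by auto
qed

text \<open>Dividing the derivative by \<open>(X - a)^(m-1)\<close> and evaluating at
  \<open>a\<close> leaves \<open>m * Q(a)\<close>.\<close>

lemma p_dvd_order_if_pderiv_eq_0:
  assumes P: "P = [:- a, 1:] ^ m * Q" and "poly Q a \<noteq> (0 :: 'a)" "pderiv P = 0"
  shows "p dvd m"
proof (cases m)
  case (Suc k)
  have "0 = [:- a, 1:] ^ k * ([:- a, 1:] * pderiv Q + smult (of_nat m) Q)"
    using assms(3) unfolding P Suc lemma_order_pderiv1 by (simp add: algebra_simps)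
  then have "[:- a, 1:] * pderiv Q + smult (of_nat m) Q = 0" by auto
  then have "poly ([:- a, 1:] * pderiv Q + smult (of_nat m) Q) a = 0" by simp
  then have "of_nat m = (0 :: 'a)" using assms(2) by simp
  then show ?thesis by (simp only: of_nat_eq_0_iff_dvd)
qed simp

text \<open>This is the lacunary form of \<open>R(X, 0)\<close>: no powers occur strictly between
  \<open>N\<close> and \<open>q\<close>.\<close>

lemma slope_poly:
  assumes f: "f ` K \<subseteq> K" and N: "card (slopes K f) < p ^ n"
  obtains G where "(\<Prod>x\<in>K. [:- f x, 1:]) = monom 1 (p ^ n) + G" "degree G \<le> card (slopes K f)"
proof
  let ?L = "\<Prod>x\<in>K. [:- f x, 1:]"
  define G where "G = ?L - monom 1 (p ^ n)"
  show "?L = monom 1 (p ^ n) + G" by (simp add: G_def)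
  have degL: "degree ?L = p ^ n" by (subst degree_prod_sum_eq) (auto simp: card_K)
  have leadL: "lead_coeff ?L = 1" by (simp add: lead_coeff_prod)
  have "0 \<in> K" "1 \<in> K" "(0 :: 'a) \<noteq> 1" by auto
  then have "(f 0 - f 1) / (0 - 1) \<in> slopes K f" by (rule slopesI)
  then have Npos: "card (slopes K f) > 0" by (auto simp: card_gt_0_iff)
  show "degree G \<le> card (slopes K f)"
  proof (rule degree_le, intro allI impI)
    fix i assume i: "card (slopes K f) < i"
    consider "i < p ^ n" | "i = p ^ n" | "i > p ^ n" by linarith
    then show "coeff G i = 0"
    proof cases
      case 1
      then have "coeff ?L i = 0"
        using coeff_redei_eq_0[OF f _ i] Npos i poly_coeff_redei[of f i 0] by simp
      then show ?thesis using 1 by (simp add: G_def)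
    next
      case 2
      then show ?thesis using degL leadL by (simp add: G_def)
    next
      case 3
      then show ?thesis using degL by (simp add: G_def coeff_eq_0)
    qed
  qed
qed

text \<open>
  Write \<open>\<Prod>\<^sub>x (X - f x) = X\<^sup>q + G = V W\<close> with \<open>V\<close> the product over the distinct roots. Then \<open>V\<close> divides
  \<open>X\<^sup>q - X\<close>, hence \<open>G + X\<close>, and \<open>W\<close> divides \<open>G'\<close>; as \<open>G\<close> has degree at most \<open>N\<close>, the product \<open>(G + X) G'\<close>
  has degree less than \<open>q\<close> and must vanish.
\<close>

lemma p_dvd_fiber:
  assumes f: "f ` K \<subseteq> K" and N: "2 * card (slopes K f) \<le> p ^ n" and slope: "0 \<in> slopes K f"
  shows "p dvd card {x\<in>K. f x = a}"
proof -
  let ?N = "card (slopes K f)"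
  let ?L = "\<Prod>x\<in>K. [:- f x, 1:]"
  let ?V = "\<Prod>a\<in>f ` K. [:- a, 1:]"
  let ?m = "\<lambda>a. card {x\<in>K. f x = a}"
  let ?W = "\<Prod>a\<in>f ` K. [:- a, 1:] ^ (?m a - 1)"
  have Npos: "?N > 0" using slope by (auto simp: card_gt_0_iff)
  have "?N < p ^ n" using N Npos by linarith
  then obtain G where G: "?L = monom 1 (p ^ n) + G" "degree G \<le> ?N" by (rule slope_poly[OF f])
  have L: "?L = (\<Prod>a\<in>f ` K. [:- a, 1:] ^ ?m a)" by (rule prod_linear_eq_prod_fiber) simp
  have m_pos: "?m a > 0" if "a \<in> f ` K" for a using that by (auto simp: card_gt_0_iff)
  have LVW: "?L = ?V * ?W"
    unfolding L prod.distrib[symmetric]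
  proof (intro prod.cong refl)
    fix a assume "a \<in> f ` K"
    then obtain k where "?m a = Suc k" using m_pos gr0_implies_Suc by blast
    then show "[:- a, 1:] ^ ?m a = [:- a, 1:] * [:- a, 1:] ^ (?m a - 1)" by simp
  qed
  define H where "H = G + monom 1 1"
  have H: "H = ?L - (\<Prod>k\<in>K. [:- k, 1:])" by (simp add: H_def G prod_linear_factors)
  have "?V dvd (\<Prod>k\<in>K. [:- k, 1:])" by (rule prod_dvd_prod_subset) (use f in auto)
  then have VH: "?V dvd H" unfolding H LVW by (intro dvd_diff) auto
  have WL: "?W dvd pderiv ?L"
    unfolding L by (rule prod_linear_power_dvd_pderiv) simp
  have dvd: "?L dvd H * pderiv ?L"
    using mult_dvd_mono[OF VH WL] LVW by simp
  \<comment> \<open>If \<open>H = 0\<close>, every element of \<open>K\<close> is a value of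
    \<open>f\<close>, so \<open>f\<close> is injective on \<open>K\<close> and 0 is not a
    slope.\<close>
  have "H \<noteq> 0"
  proof
    assume "H = 0"
    have "K \<subseteq> f ` K"
    proof
      fix k assume k: "k \<in> K"
      have "poly ?L k = poly (\<Prod>k\<in>K. [:- k, 1:]) k" using \<open>H = 0\<close> H by simp
      also have "\<dots> = 0" using k by (simp add: poly_prod prod_zero_iff)
      finally show "k \<in> f ` K" by (auto simp: poly_prod prod_zero_iff)
    qed
    then have "inj_on f K" by (intro finite_surj_inj) simp_all
    with slope show False by (auto simp: slopes_def inj_on_def)
  qed
  have pderivL: "pderiv ?L = 0"
  proof (rule ccontr)
    assume nz: "pderiv ?L \<noteq> 0"
    have "degree ?L = p ^ n" by (subst degree_prod_sum_eq) (auto simp: card_K)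
    then have "p ^ n \<le> degree (H * pderiv ?L)"
      using dvd_imp_degree_le[OF dvd] nz \<open>H \<noteq> 0\<close> by simp
    also have "\<dots> = degree H + degree (pderiv ?L)" using nz \<open>H \<noteq> 0\<close> by (simp add: degree_mult_eq)
    also have "degree H \<le> ?N"
      unfolding H_def using G(2) Npos by (intro degree_add_le) (auto simp: degree_monom_eq)
    also have "pderiv ?L = pderiv G"
      by (simp add: G pderiv_add pderiv_monom of_nat_card_K del: of_nat_power)
    also have "degree (pderiv G) \<le> degree G - 1"
      by (intro degree_le) (simp add: coeff_pderiv coeff_eq_0)
    finally show False using G(2) N Npos by linarith
  qed
  show ?thesis
  proof (rule p_dvd_order_if_pderiv_eq_0)
    show "?L = [:- a, 1:] ^ ?m a * (\<Prod>x\<in>{x\<in>K. f x \<noteq> a}. [:- f x, 1:])"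
    proof -
      have "?L = (\<Prod>x\<in>{x\<in>K. f x = a}. [:- f x, 1:]) * (\<Prod>x\<in>{x\<in>K. f x \<noteq> a}. [:- f x, 1:])"
        by (subst prod.union_disjoint[symmetric]) (auto intro!: prod.cong)
      moreover have "(\<Prod>x\<in>{x\<in>K. f x = a}. [:- f x, 1:]) = [:- a, 1:] ^ ?m a" by simp
      ultimately show ?thesis by simp
    qed
    show "poly (\<Prod>x\<in>{x\<in>K. f x \<noteq> a}. [:- f x, 1:]) a \<noteq> 0"
      by (auto simp: poly_prod prod_zero_iff)
  qed (rule pderivL)
qed

lemma char_poly: "CHAR('a poly) = p"
proof (rule CHAR_eqI)
  show "of_nat p = (0 :: 'a poly)" by (simp add: of_nat_poly)
  show "p dvd k" if "of_nat k = (0 :: 'a poly)" for k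
    using that by (simp add: of_nat_poly of_nat_eq_0_iff_dvd)
qed

lemma poly_frobenius_add: "(P + Q :: 'a poly) ^ (p ^ e) = P ^ (p ^ e) + Q ^ (p ^ e)"
  using freshmans_dream'[of "p ^ e" e P Q] prime char_poly by simp

text \<open>By the Frobenius map, a \<open>p ^ e\<close>-th power is a polynomial in
  \<open>X^(p^e)\<close>.\<close>

lemma coeff_frobenius_power:
  fixes P :: "'a poly"
  assumes "\<not> p ^ e dvd i" shows "coeff (P ^ (p ^ e)) i = 0"
proof -
  have "P ^ (p ^ e) = (\<Sum>j\<le>degree P. monom (coeff P j) j) ^ (p ^ e)"
    by (simp add: poly_as_sum_of_monoms)
  also have "\<dots> = (\<Sum>j\<le>degree P. monom (coeff P j) j ^ (p ^ e))"
    by (rule freshmans_dream_sum'[where n = e]) (simp_all only: char_poly prime)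
  finally show ?thesis
    using assms by (auto simp: coeff_sum monom_power intro!: sum.neutral)
qed

lemma slopes_shift: "slopes K (\<lambda>x. f x - y * x - c) = (\<lambda>s. s - y) ` slopes K f"
  using slopes_add_linear[of K f "- y" "- c"] by simp

lemma card_slopes_shift: "card (slopes K (\<lambda>x. f x - y * x - c)) = card (slopes K f)"
  unfolding slopes_shift by (rule card_image) (simp add: inj_on_def)

section \<open>Lines with a constant number of points\<close>

text \<open>The line of slope \<open>y\<close> and intercept \<open>a\<close> meets the graph where
  \<open>f x - y * x = a\<close>; lines missing the graph count 0 points, so the condition concerns
  only those that meet it.\<close>

definition lines_divisible :: "nat \<Rightarrow> ('a \<Rightarrow> 'a) \<Rightarrow> bool" where
  "lines_divisible d f \<longleftrightarrow> (\<forall>y\<in>slopes K f. \<forall>a. d dvd card {x\<in>K. f x - y * x = a})"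

lemma lines_divisibleD:
  "lines_divisible d f \<Longrightarrow> y \<in> slopes K f \<Longrightarrow> d dvd card {x\<in>K. f x - y * x = a}"
  by (auto simp: lines_divisible_def)

lemma lines_divisible_p:
  assumes f: "f ` K \<subseteq> K" and N: "2 * card (slopes K f) \<le> p ^ n"
  shows "lines_divisible p f"
  unfolding lines_divisible_def
proof (intro ballI allI)
  fix y a assume y: "y \<in> slopes K f"
  \<comment> \<open>The shear moves the slope \<open>y\<close> to 0; the trailing \<open>- 0\<close>
    gives \<open>?g\<close> the shape expected by \<open>slopes_shift\<close>.\<close>
  let ?g = "\<lambda>x. f x - y * x - 0"
  have "y \<in> K" using y slopes_subset[OF f] by auto
  then have g: "?g ` K \<subseteq> K" using f by auto
  have "0 \<in> slopes K ?g" unfolding slopes_shift using y by (auto simp: image_iff intro!: bexI[of _ y])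
  moreover have "2 * card (slopes K ?g) \<le> p ^ n" unfolding card_slopes_shift by (rule N)
  ultimately have "p dvd card {x\<in>K. ?g x = a}" using p_dvd_fiber[OF g] by blast
  then show "p dvd card {x\<in>K. f x - y * x = a}" by simp
qed

lemma lines_divisible_shift:
  assumes "lines_divisible d f" shows "lines_divisible d (\<lambda>x. f x - y * x - c)"
  unfolding lines_divisible_def slopes_shift
proof (intro ballI allI)
  fix y' a assume "y' \<in> (\<lambda>s. s - y) ` slopes K f"
  then have "y' + y \<in> slopes K f" by auto
  then have "d dvd card {x\<in>K. f x - (y' + y) * x = a + c}" by (rule lines_divisibleD[OF assms])
  moreover have "{x\<in>K. f x - y * x - c - y' * x = a} = {x\<in>K. f x - (y' + y) * x = a + c}"
    by (auto simp: algebra_simps)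
  ultimately show "d dvd card {x\<in>K. f x - y * x - c - y' * x = a}" by simp
qed

text \<open>At a slope, \<open>R\<close> specialises to a \<open>p ^ e\<close>-th power, elsewhere
  to \<open>X^q - X\<close>. So the coefficient vanishes at all \<open>q\<close> elements of
  \<open>K\<close>, while its degree in \<open>Y\<close> is at most \<open>q - i < q\<close>. The
  term \<open>X\<close> of \<open>X^q - X\<close> is the reason for excluding
  \<open>i = 1\<close>.\<close>

lemma coeff_redei_sparse:
  assumes f: "f ` K \<subseteq> K" and div: "lines_divisible (p ^ e) f" and "e \<le> n"
    and i: "\<not> p ^ e dvd i" "i \<noteq> 1"
  shows "coeff (redei f) i = 0"
proof (cases "i < p ^ n")
  case False
  moreover have "i \<noteq> p ^ n" using i \<open>e \<le> n\<close> le_imp_power_dvd by metis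
  ultimately show ?thesis by (intro coeff_redei_above) simp
next
  case True
  have "i \<noteq> 0" using i(1) by (metis dvd_0_right)
  then have i1: "1 < i" using i by linarith
  show ?thesis
  proof (rule poly_eqI_degree[where A = K])
    fix y assume y: "y \<in> K"
    show "poly (coeff (redei f) i) y = poly 0 y"
    proof (cases "y \<in> slopes K f")
      case False
      then show ?thesis
        using y i1 True by (simp add: poly_coeff_redei prod_linear_non_slope[OF f] del: minus_diff_eq)
    next
      case y: True
      let ?m = "\<lambda>a. card {x\<in>K. f x - y * x = a}"
      have "(\<Prod>x\<in>K. [:- (f x - y * x), 1:]) = (\<Prod>a\<in>(\<lambda>x. f x - y * x) ` K. [:- a, 1:] ^ ?m a)"
        by (rule prod_linear_eq_prod_fiber) simp
      also have "\<dots> = (\<Prod>a\<in>(\<lambda>x. f x - y * x) ` K. [:- a, 1:] ^ (?m a div p ^ e)) ^ (p ^ e)"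
        using lines_divisibleD[OF div y]
        by (simp add: prod_power_distrib power_mult[symmetric])
      finally show ?thesis
        using i by (simp add: poly_coeff_redei coeff_frobenius_power del: minus_diff_eq)
    qed
  next
    show "degree (coeff (redei f) i) < card K" "degree (0 :: 'a poly) < card K"
      using degree_coeff_redei[of f i] i1 True p_gt_1 by (auto simp: card_K)
  qed
qed

text \<open>Differentiation kills the powers with exponent divisible by \<open>p\<close>, and among
  the others only \<open>X\<close> itself occurs in \<open>R\<close>.\<close>

lemma pderiv_redei:
  assumes f: "f ` K \<subseteq> K" and div: "lines_divisible p f"
  shows "pderiv (redei f) = [:coeff (redei f) 1:]"
proof (rule poly_eqI)
  fix i
  show "coeff (pderiv (redei f)) i = coeff [:coeff (redei f) 1:] i"
  proof (cases i)
    case 0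
    then show ?thesis by (simp add: coeff_pderiv)
  next
    case (Suc j)
    have "of_nat (Suc i) * coeff (redei f) (Suc i) = 0"
    proof (cases "p dvd Suc i")
      case True
      then have "of_nat (Suc i) = (0 :: 'a)" by (simp only: of_nat_eq_0_iff_dvd)
      then have "of_nat (Suc i) = (0 :: 'a poly)" by (simp only: of_nat_poly pCons_0_0)
      then show ?thesis by (simp only: mult_zero_left)
    next
      case False
      then have "coeff (redei f) (Suc i) = 0"
        using coeff_redei_sparse[OF f, of 1 "Suc i"] div n_pos Suc by simp
      then show ?thesis by simp
    qed
    then show ?thesis using Suc by (simp add: coeff_pderiv del: of_nat_Suc)
  qed
qed

text \<open>
  On the curve \<open>X = a - x\<^sub>0 Y\<close> with \<open>f x\<^sub>0 = a\<close> all but one summand of \<open>\<partial>R/\<partial>X\<close> vanish, which exposes the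
  order at \<open>Y = 0\<close> of the polynomial \<open>\<partial>R/\<partial>X\<close> in \<open>Y\<close>. That order does not depend on \<open>a\<close>.
\<close>

lemma card_fiber:
  assumes f: "f ` K \<subseteq> K" and div: "lines_divisible p f" and a: "a \<in> f ` K"
  shows "card {x\<in>K. f x = a} = Suc (order 0 (coeff (redei f) 1))"
proof -
  let ?Z = "{x\<in>K. f x = a}"
  obtain x0 where x0: "x0 \<in> ?Z" using a by auto
  let ?l = "\<lambda>x. [:a - f x, x - x0:]"
  have "pderiv (redei f) = (\<Sum>x\<in>K. \<Prod>x'\<in>K - {x}. [:[:- f x', x':], 1:])"
    unfolding redei_def pderiv_prod by (simp add: pderiv_pCons one_pCons[symmetric])
  then have "poly (pderiv (redei f)) [:a, - x0:] = (\<Sum>x\<in>K. \<Prod>x'\<in>K - {x}. ?l x')"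
    by (simp add: poly_sum poly_prod)
  also have "\<dots> = (\<Sum>x\<in>{x0}. \<Prod>x'\<in>K - {x}. ?l x')"
    using x0 by (intro sum.mono_neutral_right) (auto intro!: bexI[of _ x0])
  also have "\<dots> = (\<Prod>x\<in>K - {x0}. ?l x)" by simp
  also have "K - {x0} = (?Z - {x0}) \<union> (K - ?Z)" using x0 by auto
  also have "(\<Prod>x\<in>(?Z - {x0}) \<union> (K - ?Z). ?l x) = (\<Prod>x\<in>?Z - {x0}. ?l x) * (\<Prod>x\<in>K - ?Z. ?l x)"
    by (rule prod.union_disjoint) auto
  \<comment> \<open>Factors over the fibre of \<open>a\<close> are constant multiples of
    \<open>Y\<close>; the remaining ones have constant term \<open>a - f x \<noteq> 0\<close>. So
    the order at 0 counts the fibre without \<open>x0\<close>.\<close>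
  also have "(\<Prod>x\<in>?Z - {x0}. ?l x) = (\<Prod>x\<in>?Z - {x0}. [:- 0, 1:] * [:x - x0:])"
    by (intro prod.cong) auto
  also have "\<dots> = [:- 0, 1:] ^ card (?Z - {x0}) * (\<Prod>x\<in>?Z - {x0}. [:x - x0:])"
    by (simp only: prod.distrib prod_constant)
  finally have \<sigma>: "coeff (redei f) 1 = [:- 0, 1:] ^ card (?Z - {x0}) *
      ((\<Prod>x\<in>?Z - {x0}. [:x - x0:]) * (\<Prod>x\<in>K - ?Z. ?l x))"
    by (simp add: pderiv_redei[OF f div] mult.assoc)
  have "order 0 (coeff (redei f) 1) = card (?Z - {x0})"
    unfolding \<sigma> by (rule order_linear_power_mult) (auto simp: poly_prod prod_zero_iff)
  moreover have "card ?Z = Suc (card (?Z - {x0}))" using x0 by (intro card.remove) simp_all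
  ultimately show ?thesis by simp
qed

text \<open>After a shear the lines become fibres of equal size \<open>m\<close>. They partition
  \<open>K\<close>, so \<open>m\<close> divides \<open>p ^ n\<close>.\<close>

lemma card_line:
  assumes f: "f ` K \<subseteq> K" and div: "lines_divisible p f" and y: "y \<in> K"
  obtains e where "\<And>a. a \<in> (\<lambda>x. f x - y * x) ` K \<Longrightarrow> card {x\<in>K. f x - y * x = a} = p ^ e"
proof -
  let ?g = "\<lambda>x. f x - y * x"
  define m where "m = Suc (order 0 (coeff (redei ?g) 1))"
  have "?g ` K \<subseteq> K" using f y by auto
  moreover have "lines_divisible p ?g" using lines_divisible_shift[OF div, of y 0] by simp
  ultimately have fib: "card {x\<in>K. ?g x = a} = m" if "a \<in> ?g ` K" for a
    using card_fiber[of ?g a] that by (simp add: m_def)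
  have "card K = (\<Sum>a\<in>?g ` K. card {x\<in>K. ?g x = a})"
    using sum.image_gen[of K "\<lambda>_. 1 :: nat" ?g] by simp
  also have "\<dots> = card (?g ` K) * m" by (simp add: fib)
  finally have "m dvd p ^ n" by (simp add: card_K)
  then obtain e where "m = p ^ e" using prime divides_primepow_nat by blast
  then show ?thesis using fib that by blast
qed

text \<open>
  The line of a slope with the fewest points per line is moved to the horizontal axis.
\<close>

lemma normalized_function:
  assumes f: "f ` K \<subseteq> K" and div: "lines_divisible p f" and "\<not> affine_fun K f"
  obtains g e where "g ` K \<subseteq> K" "card (slopes K g) = card (slopes K f)" "g 0 = 0"
    "1 \<le> e" "e < n" "lines_divisible (p ^ e) g"
    "\<And>a. a \<in> g ` K \<Longrightarrow> card {x\<in>K. g x = a} = p ^ e"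
proof -
  have "\<exists>e. \<forall>a\<in>(\<lambda>x. f x - y * x) ` K. card {x\<in>K. f x - y * x = a} = p ^ e" if "y \<in> slopes K f" for y
  proof -
    have "y \<in> K" using that slopes_subset[OF f] by blast
    then show ?thesis by (rule card_line[OF f div]) blast
  qed
  then have "\<exists>E. \<forall>y\<in>slopes K f. \<forall>a\<in>(\<lambda>x. f x - y * x) ` K. card {x\<in>K. f x - y * x = a} = p ^ E y"
    by (intro bchoice) blast
  then obtain E where E: "\<And>y a. y \<in> slopes K f \<Longrightarrow> a \<in> (\<lambda>x. f x - y * x) ` K \<Longrightarrow>
      card {x\<in>K. f x - y * x = a} = p ^ E y" by blast
  have "(f 0 - f 1) / (0 - 1) \<in> slopes K f" by (rule slopesI) auto
  then obtain y where y: "y \<in> slopes K f" and min: "\<And>y'. y' \<in> slopes K f \<Longrightarrow> E y \<le> E y'"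
    using ex_has_least_nat[of "\<lambda>y. y \<in> slopes K f" _ E] by blast
  have yK: "y \<in> K" using y slopes_subset[OF f] by auto
  define g where "g = (\<lambda>x. f x - y * x - f 0)"
  have gK: "g ` K \<subseteq> K" using f yK by (auto simp: g_def image_subset_iff)
  have fib: "card {x\<in>K. g x = a} = p ^ E y" if "a \<in> g ` K" for a
  proof -
    have "{x\<in>K. g x = a} = {x\<in>K. f x - y * x = a + f 0}" by (auto simp: g_def algebra_simps)
    moreover have "a + f 0 \<in> (\<lambda>x. f x - y * x) ` K" using that by (auto simp: g_def)
    ultimately show ?thesis using E[OF y] by simp
  qed
  have g0: "0 \<in> g ` K" by (rule image_eqI[of _ _ 0]) (simp_all add: g_def)
  show ?thesis
  proof (rule that[of g "E y"])
    show "g ` K \<subseteq> K" by fact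
    show "card (slopes K g) = card (slopes K f)" unfolding g_def by (rule card_slopes_shift)
    show "g 0 = 0" by (simp add: g_def)
    have "p dvd card {x\<in>K. f x - y * x = f 0}" by (rule lines_divisibleD[OF div y])
    also have "{x\<in>K. f x - y * x = f 0} = {x\<in>K. g x = 0}" by (auto simp: g_def)
    finally have "p dvd p ^ E y" using fib[OF g0] by simp
    then show "1 \<le> E y" using p_gt_1 by (cases "E y") auto
    \<comment> \<open>Otherwise one line of slope \<open>y\<close> contains the whole graph, and
      \<open>f\<close> is affine.\<close>
    show "E y < n"
    proof (rule ccontr)
      assume "\<not> E y < n"
      then have "card K \<le> card {x\<in>K. g x = 0}"
        using fib[OF g0] p_gt_1 by (simp add: card_K)
      then have "{x\<in>K. g x = 0} = K" by (intro card_seteq) auto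
      then have "f x - (y * x + f 0) = 0" if "x \<in> K" for x
        using that unfolding g_def diff_diff_eq by blast
      then have "\<forall>x\<in>K. f x = y * x + f 0" unfolding right_minus_eq by blast
      then show False using \<open>\<not> affine_fun K f\<close> unfolding affine_fun_def by blast
    qed
    show "lines_divisible (p ^ E y) g"
      unfolding lines_divisible_def
    proof (intro ballI allI)
      fix y' a assume "y' \<in> slopes K g"
      then have y': "y' + y \<in> slopes K f" by (auto simp: g_def slopes_shift)
      have eq: "{x\<in>K. g x - y' * x = a} = {x\<in>K. f x - (y' + y) * x = a + f 0}"
        by (auto simp: g_def algebra_simps)
      \<comment> \<open>A line that meets the graph has \<open>p ^ E (y' + y)\<close> points, and
        \<open>E y\<close> is minimal.\<close>
      show "p ^ E y dvd card {x\<in>K. g x - y' * x = a}"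
      proof (cases "{x\<in>K. g x - y' * x = a} = {}")
        case False
        then obtain x where "x \<in> K" "f x - (y' + y) * x = a + f 0" unfolding eq by blast
        then have "a + f 0 \<in> (\<lambda>x. f x - (y' + y) * x) ` K" by (intro image_eqI[of _ _ x]) simp_all
        then have "card {x\<in>K. f x - (y' + y) * x = a + f 0} = p ^ E (y' + y)" by (rule E[OF y'])
        then show ?thesis unfolding eq using min[OF y'] by (simp add: le_imp_power_dvd)
      qed (metis card.empty dvd_0_right)
    qed
  qed (rule fib)
qed

section \<open>The number of slopes over a non-prime field\<close>

lemma power_p_ge_2:
  assumes "1 \<le> k" shows "2 \<le> p ^ k"
proof -
  have "p ^ 1 \<le> p ^ k" using assms p_gt_1 by (intro power_increasing) auto
  then show ?thesis using p_gt_1 by simp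
qed

text \<open>
  Here \<open>\<Prod>\<^sub>x (X - f x) = (X\<^sup>r + h)\<^sup>s\<close> with \<open>r s = q\<close>, and a root \<open>a\<close> satisfies
  \<open>a = a\<^sup>q = (a\<^sup>r)\<^sup>s = - h(a)\<^sup>s\<close>.
\<close>

lemma card_slopes_ge_fiber:
  assumes f: "f ` K \<subseteq> K" and N: "card (slopes K f) < p ^ n" and e: "1 \<le> e" "e < n"
    and fib: "\<And>a. a \<in> f ` K \<Longrightarrow> card {x\<in>K. f x = a} = p ^ e"
  shows "p ^ (n - e) \<le> card (slopes K f)"
proof -
  let ?N = "card (slopes K f)"
  let ?r = "p ^ (n - e)"
  have r: "p ^ n = ?r * p ^ e" using e by (simp flip: power_add)
  have "card K = (\<Sum>a\<in>f ` K. card {x\<in>K. f x = a})"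
    using sum.image_gen[of K "\<lambda>_. 1 :: nat" f] by simp
  also have "\<dots> = card (f ` K) * p ^ e" by (simp add: fib)
  finally have card_image: "card (f ` K) = ?r" using p_gt_1 by (simp add: card_K r)
  define Q where "Q = (\<Prod>a\<in>f ` K. [:- a, 1:])"
  define h where "h = Q - monom 1 ?r"
  have "(\<Prod>x\<in>K. [:- f x, 1:]) = (\<Prod>a\<in>f ` K. [:- a, 1:] ^ p ^ e)"
    by (subst prod_linear_eq_prod_fiber) (simp_all add: fib)
  also have "\<dots> = Q ^ p ^ e" by (simp add: Q_def prod_power_distrib)
  also have "Q = monom 1 ?r + h" by (simp add: h_def)
  finally have L: "(\<Prod>x\<in>K. [:- f x, 1:]) = monom 1 (p ^ n) + h ^ p ^ e"
    by (simp add: poly_frobenius_add monom_power r)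
  obtain G where "(\<Prod>x\<in>K. [:- f x, 1:]) = monom 1 (p ^ n) + G" "degree G \<le> ?N"
    by (rule slope_poly[OF f N])
  with L have deg: "degree (h ^ p ^ e) \<le> ?N" by simp
  define T where "T = h ^ p ^ e + monom 1 1"
  have "f ` K \<subseteq> {a. poly T a = 0}"
  proof
    fix a assume a: "a \<in> f ` K"
    then have "poly Q a = 0" by (auto simp: Q_def poly_prod prod_zero_iff)
    then have "poly h a = - (a ^ ?r)" by (simp add: h_def poly_monom)
    then have "poly (h ^ p ^ e) a = - ((a ^ ?r) ^ p ^ e)" by (simp add: frobenius_uminus)
    also have "(a ^ ?r) ^ p ^ e = a ^ (p ^ n)" by (simp add: r power_mult)
    also have "\<dots> = a" using a f by (intro power_card) auto
    finally show "a \<in> {a. poly T a = 0}" by (simp add: T_def poly_monom)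
  qed
  then have le: "?r \<le> card {a. poly T a = 0}" unfolding card_image[symmetric] by (intro card_mono) auto
  \<comment> \<open>The exponents in \<open>h ^ p ^ e\<close> are multiples of
    \<open>p ^ e > 1\<close>, so the linear term of \<open>T\<close> cannot cancel.\<close>
  have "\<not> p ^ e dvd 1" using e p_gt_1 by (cases e) auto
  then have "coeff T 1 = 1" by (simp add: T_def coeff_frobenius_power del: One_nat_def)
  then have "T \<noteq> 0" by auto
  note le
  also have "card {a. poly T a = 0} \<le> degree T" by (rule card_poly_roots_bound) fact
  also have "\<dots> \<le> max ?N 1" unfolding T_def
    using deg by (intro degree_add_le) (auto simp: degree_monom_eq le_max_iff_disj)
  finally have "?r \<le> max ?N 1" .
  moreover have "?r \<ge> 2" using e by (intro power_p_ge_2) simp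
  ultimately show ?thesis by simp
qed

text \<open>Count points on the lines through \<open>(0, f 0)\<close> whose slope is a slope of
  \<open>f\<close>: the other \<open>q - 1\<close> points occur once each, the base point once per
  slope, and every line contributes a multiple of \<open>p\<close>.\<close>

lemma p_dvd_card_slopes:
  assumes f: "f ` K \<subseteq> K" and div: "lines_divisible p f"
  shows "p dvd p ^ n - 1 + card (slopes K f)"
proof -
  let ?s = "\<lambda>x. (f x - f 0) / x"
  have card_class: "card {x\<in>K. f x - y * x = f 0} = Suc (card {x\<in>K - {0}. ?s x = y})" for y
  proof -
    have "{x\<in>K. f x - y * x = f 0} = insert 0 {x\<in>K - {0}. ?s x = y}"
      by (auto simp: field_simps)
    then show ?thesis by simp
  qed
  have sub: "?s ` (K - {0}) \<subseteq> slopes K f"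
  proof
    fix y assume "y \<in> ?s ` (K - {0})"
    then obtain x where x: "x \<in> K" "x \<noteq> 0" "y = ?s x" by auto
    then show "y \<in> slopes K f" using slopesI[of x K 0 f] by simp
  qed
  have "p ^ n - 1 + card (slopes K f) = card (K - {0}) + card (slopes K f)"
    by (simp add: card_K)
  also have "card (K - {0}) = (\<Sum>y\<in>?s ` (K - {0}). card {x\<in>K - {0}. ?s x = y})"
    using sum.image_gen[of "K - {0}" "\<lambda>_. 1 :: nat" ?s] by simp
  also have "\<dots> = (\<Sum>y\<in>slopes K f. card {x\<in>K - {0}. ?s x = y})"
    using sub by (intro sum.mono_neutral_left) auto
  also have "\<dots> + card (slopes K f) = (\<Sum>y\<in>slopes K f. Suc (card {x\<in>K - {0}. ?s x = y}))"
    by (simp add: sum_Suc)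
  also have "\<dots> = (\<Sum>y\<in>slopes K f. card {x\<in>K. f x - y * x = f 0})"
    by (simp only: card_class)
  also have "p dvd \<dots>" by (intro dvd_sum lines_divisibleD[OF div])
  finally show ?thesis .
qed

text \<open>If \<open>e\<close> does not divide \<open>n\<close>, combining
  \<open>w ^ p ^ e = w\<close> with \<open>w ^ p ^ n = w\<close> gives \<open>w ^ p ^ r = w\<close>
  for the remainder \<open>r < e\<close>, an equation with fewer than \<open>p ^ e\<close>
  solutions.\<close>

lemma exponent_dvd:
  assumes S: "S \<subseteq> K" "card S = p ^ e" "\<And>w. w \<in> S \<Longrightarrow> w ^ p ^ e = w" and e: "1 \<le> e"
  shows "e dvd n"
proof (rule ccontr)
  assume "\<not> e dvd n"
  define r where "r = n mod e"
  have r: "0 < r" "r < e" using e \<open>\<not> e dvd n\<close> by (auto simp: r_def mod_greater_zero_iff_not_dvd)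
  have iter: "w ^ p ^ (e * d) = w" if "w \<in> S" for w d
    using that S(3) by (induction d) (simp_all add: power_add power_mult)
  have fixed: "w ^ p ^ r = w" if "w \<in> S" for w
  proof -
    have "w = w ^ p ^ n" using that S(1) power_card by auto
    also have "n = e * (n div e) + r" by (simp add: r_def)
    also have "w ^ p ^ \<dots> = w ^ p ^ r" using iter[OF that] by (simp add: power_add power_mult)
    finally show ?thesis by simp
  qed
  define T where "T = monom 1 (p ^ r) - monom (1 :: 'a) 1"
  have pr: "p ^ r \<noteq> 1" using r p_gt_1 by simp
  then have "coeff T 1 \<noteq> 0" by (simp add: T_def)
  then have "T \<noteq> 0" by auto
  have "card S \<le> card {w. poly T w = 0}"
    using fixed by (intro card_mono) (auto simp: T_def poly_monom)
  also have "\<dots> \<le> degree T" by (rule card_poly_roots_bound) fact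
  also have "\<dots> \<le> p ^ r"
    unfolding T_def using p_gt_1 by (intro degree_diff_le) (auto simp: degree_monom_eq)
  finally show False using r p_gt_1 by (simp add: S(2))
qed

text \<open>
  Both sides are the coefficient of \<open>Y\<^sup>s\<close> in \<open>R(t Y, Y)\<close>; on the left only the powers
  \<open>X\<^sup>0\<close>, \<open>X\<^sup>1\<close>, \<open>X\<^sup>s\<close> contribute, because the others up to \<open>X\<^sup>s\<close> do not occur in \<open>R\<close>.
\<close>

lemma fiber_polynomial:
  assumes f: "f ` K \<subseteq> K" and div: "lines_divisible (p ^ e) f" and e: "1 \<le> e" "e \<le> n"
    and fib: "card {x\<in>K. f x = 0} = p ^ e"
  obtains c0 c1 c2 C where "C \<noteq> 0"
    "\<And>t. c0 + c1 * t + c2 * t ^ p ^ e = C * (\<Prod>x\<in>{x\<in>K. f x = 0}. t + x)"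
proof
  let ?Z = "{x\<in>K. f x = 0}"
  let ?s = "p ^ e"
  let ?c = "\<lambda>i. coeff (coeff (redei f) i) (?s - i)"
  define C where "C = (\<Prod>x\<in>K - ?Z. - f x)"
  show "C \<noteq> 0" by (auto simp: C_def prod_zero_iff)
  fix t
  have s2: "?s \<ge> 2" using e by (intro power_p_ge_2)
  have "poly (redei f) [:0, t:] = (\<Prod>x\<in>K. [:- f x, t + x:])"
    by (simp add: redei_def poly_prod add.commute)
  also have "\<dots> = (\<Prod>x\<in>?Z. [:- f x, t + x:]) * (\<Prod>x\<in>K - ?Z. [:- f x, t + x:])"
    by (subst mult.commute, rule prod.subset_diff) auto
  \<comment> \<open>Over the fibre of 0 each factor is \<open>(t + x) Y\<close>, so the fibre
    supplies exactly \<open>Y^s\<close> and the other factors contribute their constant term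
    \<open>C\<close>.\<close>
  also have "(\<Prod>x\<in>?Z. [:- f x, t + x:]) = (\<Prod>x\<in>?Z. monom (t + x) 1)"
    by (intro prod.cong) (auto simp: monom_altdef)
  also have "\<dots> = monom (\<Prod>x\<in>?Z. t + x) ?s"
  proof -
    have "(\<Prod>x\<in>A. monom (t + x) 1) = monom (\<Prod>x\<in>A. t + x) (card A)" if "finite A" for A
      using that by (induction A rule: finite_induct) (simp_all add: mult_monom monom_0[symmetric] flip: one_pCons monom_eq_1)
    then show ?thesis using fib by simp
  qed
  finally have "coeff (poly (redei f) [:0, t:]) ?s
      = (\<Prod>x\<in>?Z. t + x) * coeff (\<Prod>x\<in>K - ?Z. [:- f x, t + x:]) 0"
    by (simp add: coeff_monom_mult)
  also have "coeff (\<Prod>x\<in>K - ?Z. [:- f x, t + x:]) 0 = C"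
    by (simp add: poly_0_coeff_0[symmetric] poly_prod C_def)
  finally have "C * (\<Prod>x\<in>?Z. t + x) = coeff (poly (redei f) [:0, t:]) ?s" by (simp add: mult.commute)
  also have "poly (redei f) [:0, t:] = (\<Sum>i\<le>p ^ n. coeff (redei f) i * monom (t ^ i) i)"
  proof -
    have "degree (redei f) \<le> p ^ n" by (intro degree_le) (simp add: coeff_redei_above)
    then have "poly (redei f) [:0, t:] = (\<Sum>i\<le>p ^ n. coeff (redei f) i * [:0, t:] ^ i)"
      unfolding poly_altdef by (intro sum.mono_neutral_left) (auto simp: coeff_eq_0)
    moreover have "[:0, t:] = monom t 1" by (simp add: monom_altdef)
    then have "[:0, t:] ^ i = monom (t ^ i) i" for i by (simp only: monom_power mult_1)
    ultimately show ?thesis by simp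
  qed
  also have "coeff \<dots> ?s = (\<Sum>i\<le>p ^ n. if i \<le> ?s then t ^ i * ?c i else 0)"
    unfolding coeff_sum by (intro sum.cong refl) (simp add: mult.commute[of _ "monom _ _"] coeff_monom_mult)
  also have "\<dots> = (\<Sum>i\<in>{0, 1, ?s}. if i \<le> ?s then t ^ i * ?c i else 0)"
  proof (rule sum.mono_neutral_right)
    have "?s \<le> p ^ n" using e p_gt_1 by (intro power_increasing) auto
    then show "{0, 1, ?s} \<subseteq> {..p ^ n}" using s2 by auto
    show "\<forall>i\<in>{..p ^ n} - {0, 1, ?s}. (if i \<le> ?s then t ^ i * ?c i else 0) = 0"
    proof
      fix i assume i: "i \<in> {..p ^ n} - {0, 1, ?s}"
      show "(if i \<le> ?s then t ^ i * ?c i else 0) = 0"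
      proof (cases "i \<le> ?s")
        case True
        then have "\<not> ?s dvd i" using i by (auto dest: dvd_imp_le)
        then have "coeff (redei f) i = 0"
          using i by (intro coeff_redei_sparse[OF f div e(2)]) auto
        then show ?thesis by simp
      qed simp
    qed
  qed simp
  also have "\<dots> = ?c 0 + ?c 1 * t + ?c ?s * t ^ ?s"
  proof -
    have "?s \<noteq> 0" "?s \<noteq> 1" "1 \<le> ?s" using s2 by linarith+
    then have "0 \<notin> {1, ?s}" "1 \<notin> {?s}" by (metis insert_iff empty_iff zero_neq_one)+
    then show ?thesis using \<open>1 \<le> ?s\<close> by (simp add: mult.commute del: One_nat_def)
  qed
  finally show "?c 0 + ?c 1 * t + ?c ?s * t ^ ?s = C * (\<Prod>x\<in>?Z. t + x)" by simp
qed

text \<open>Setting \<open>t = - x\<close> makes the fibre a root set of a polynomial with terms 1,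
  \<open>x\<close>, \<open>x^s\<close>. Differences \<open>u\<close> of roots satisfy
  \<open>c1 * u + c2 * u ^ s = 0\<close>; dividing by one nonzero difference yields \<open>s\<close>
  solutions of \<open>w^s = w\<close> in \<open>K\<close>.\<close>

lemma fiber_exponent_dvd:
  assumes f: "f ` K \<subseteq> K" and div: "lines_divisible (p ^ e) f" and e: "1 \<le> e" "e < n"
    and fib: "card {x\<in>K. f x = 0} = p ^ e"
  shows "e dvd n"
proof -
  let ?Z = "{x\<in>K. f x = 0}"
  let ?s = "p ^ e"
  obtain c0 c1 c2 C where C: "C \<noteq> 0"
    and eq: "\<And>t. c0 + c1 * t + c2 * t ^ ?s = C * (\<Prod>x\<in>?Z. t + x)"
    by (rule fiber_polynomial[OF f div e(1) less_imp_le[OF e(2)] fib], rule that)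
  have root: "c0 - c1 * x - c2 * x ^ ?s = 0" if "x \<in> ?Z" for x
    using eq[of "- x"] that by (auto simp: frobenius_uminus prod_zero_iff)
  have diff: "c1 * (x - x') + c2 * (x - x') ^ ?s = 0" if "x \<in> ?Z" "x' \<in> ?Z" for x x'
    using root[OF that(1)] root[OF that(2)] by (simp add: frobenius_diff algebra_simps)
  have "card ?Z \<ge> 2" using e(1) by (simp only: fib power_p_ge_2)
  then obtain x0 x1 where x01: "x0 \<in> ?Z" "x1 \<in> ?Z" "x0 \<noteq> x1"
  proof -
    have "\<not> card ?Z \<le> Suc 0" using \<open>card ?Z \<ge> 2\<close> by simp
    then have "\<not> (\<forall>x0\<in>?Z. \<forall>x1\<in>?Z. x0 = x1)" by (subst (asm) card_le_Suc0_iff_eq) simp_all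
    then show ?thesis using that by blast
  qed
  \<comment> \<open>If \<open>c2 = 0\<close>, two distinct roots force all coefficients to vanish,
    but at \<open>t = - z\<close> with \<open>z\<close> outside the fibre the product is
    nonzero.\<close>
  have "c2 \<noteq> 0"
  proof
    assume c2: "c2 = 0"
    then have "c1 = 0" using diff[OF x01(1,2)] x01(3) by simp
    then have "c0 = 0" using root[OF x01(1)] c2 by (simp del: mem_Collect_eq)
    have "card ?Z < card K" using fib e p_gt_1 by (simp add: card_K)
    then have "\<not> K \<subseteq> ?Z" using card_mono[of ?Z K] by auto
    then obtain z where z: "z \<in> K" "z \<notin> ?Z" by blast
    have "(\<Prod>x\<in>?Z. - z + x) = 0" using eq[of "- z"] C \<open>c0 = 0\<close> \<open>c1 = 0\<close> c2 by simp
    then show False using z by (auto simp: prod_zero_iff)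
  qed
  define \<delta> where "\<delta> = x1 - x0"
  have \<delta>: "\<delta> \<noteq> 0" using x01 by (simp add: \<delta>_def)
  have pow: "(x - x0) ^ ?s = - (c1 / c2) * (x - x0)" if "x \<in> ?Z" for x
  proof -
    have "c2 * (x - x0) ^ ?s = - c1 * (x - x0)"
      using diff[OF that x01(1)] by (simp add: eq_neg_iff_add_eq_0 add.commute)
    moreover have "(x - x0) ^ ?s = c2 * (x - x0) ^ ?s / c2" using \<open>c2 \<noteq> 0\<close> by simp
    ultimately show ?thesis by simp
  qed
  have "c1 \<noteq> 0" using pow[OF x01(2)] \<delta> by (auto simp: \<delta>_def)
  show ?thesis
  proof (rule exponent_dvd[OF _ _ _ e(1)])
    let ?S = "(\<lambda>x. (x - x0) / \<delta>) ` ?Z"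
    show "?S \<subseteq> K" using x01 by (auto simp: \<delta>_def)
    have "inj_on (\<lambda>x. (x - x0) / \<delta>) ?Z" using \<delta> by (auto simp: inj_on_def)
    then show "card ?S = ?s" using fib by (simp add: card_image)
    fix w assume "w \<in> ?S"
    then obtain x where x: "x \<in> ?Z" "w = (x - x0) / \<delta>" by blast
    have "w ^ ?s = (- (c1 / c2) * (x - x0)) / (- (c1 / c2) * \<delta>)"
      using pow[OF x(1)] pow[OF x01(2)] by (simp add: x(2) power_divide \<delta>_def)
    also have "\<dots> = w" using \<open>c1 \<noteq> 0\<close> \<open>c2 \<noteq> 0\<close> by (simp add: x(2))
    finally show "w ^ ?s = w" .
  qed
qed

text \<open>If \<open>N \<le> p ^ (n - k)\<close>, then \<open>2 * N \<le> q\<close> because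
  \<open>k \<ge> 1\<close>, so the fibre results apply. The exponent \<open>e\<close> divides
  \<open>n\<close>, hence \<open>e \<le> k\<close>, and \<open>p ^ (n - e) \<le> N\<close> forces
  \<open>N = p ^ (n - k)\<close>. This is divisible by \<open>p\<close>, against
  \<open>N = 1\<close> modulo \<open>p\<close>.\<close>

lemma card_slopes_composite:
  assumes f: "f ` K \<subseteq> K" and "\<not> affine_fun K f" and n: "n > 1"
  shows "p ^ (n - Max {k. k dvd n \<and> k < n}) + 1 \<le> card (slopes K f)"
proof (rule ccontr)
  define k where "k = Max {k. k dvd n \<and> k < n}"
  have "finite {k. k dvd n \<and> k < n}" by simp
  then have kmax: "d \<le> k" if "d dvd n" "d < n" for d
    unfolding k_def using that by (intro Max_ge) auto
  have "k \<in> {k. k dvd n \<and> k < n}" unfolding k_def using n by (intro Max_in) auto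
  then have k: "1 \<le> k" "k < n" using kmax[of 1] n by auto
  assume "\<not> p ^ (n - Max {k. k dvd n \<and> k < n}) + 1 \<le> card (slopes K f)"
  then have N: "card (slopes K f) \<le> p ^ (n - k)" by (simp add: k_def)
  have "2 * card (slopes K f) \<le> p * p ^ (n - k)" using p_gt_1 N by (intro mult_mono) auto
  also have "\<dots> = p ^ Suc (n - k)" by simp
  also have "\<dots> \<le> p ^ n" using k p_gt_1 by (intro power_increasing) auto
  finally have N2: "2 * card (slopes K f) \<le> p ^ n" .
  have div: "lines_divisible p f" by (rule lines_divisible_p[OF f N2])
  obtain g e where g: "g ` K \<subseteq> K" "card (slopes K g) = card (slopes K f)" "g 0 = 0"
    "1 \<le> e" "e < n" "lines_divisible (p ^ e) g"
    "\<And>a. a \<in> g ` K \<Longrightarrow> card {x\<in>K. g x = a} = p ^ e"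
    by (rule normalized_function[OF f div assms(2)]) blast
  have "g 0 \<in> g ` K" by simp
  then have "card {x\<in>K. g x = 0} = p ^ e" using g(3,7) by metis
  then have "e dvd n" by (rule fiber_exponent_dvd[OF g(1,6,4,5)])
  then have "e \<le> k" using kmax g(5) by simp
  have "card (slopes K g) < p ^ n" using N2 g(2) card_K_ge_2 by linarith
  then have "p ^ (n - e) \<le> card (slopes K f)"
    using card_slopes_ge_fiber[OF g(1) _ g(4,5,7)] g(2) by simp
  moreover have "p ^ (n - k) \<le> p ^ (n - e)"
    using p_gt_1 \<open>e \<le> k\<close> by (intro power_increasing) auto
  ultimately have "card (slopes K f) = p ^ (n - k)" using N by linarith
  then have "p dvd card (slopes K f)" using k by (simp add: dvd_power)
  then have "p dvd p ^ n - 1"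
    using p_dvd_card_slopes[OF f div] by (simp add: dvd_add_left_iff)
  moreover have "p dvd p ^ n" using n_pos by (simp add: dvd_power)
  ultimately have "p dvd p ^ n - (p ^ n - 1)" by (rule dvd_diff_nat[rotated])
  then have "p dvd 1" using card_K_ge_2 by simp
  then show False using p_gt_1 by simp
qed

section \<open>The number of slopes over a prime field\<close>

text \<open>Let \<open>S\<close> be the sum of \<open>(x Y - f x)^k\<close> over \<open>K\<close>
  with \<open>k = i + j\<close>. It vanishes at the non-slopes, at least \<open>k\<close> in number,
  where \<open>f x - y * x\<close> permutes \<open>K\<close>; its coefficient at \<open>Y^k\<close>
  is a vanishing power sum. So \<open>S = 0\<close>, and its coefficient at \<open>Y^i\<close> is
  the claim up to a binomial coefficient prime to \<open>p\<close>.\<close>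

lemma mixed_power_sum:
  assumes f: "f ` K \<subseteq> K" and n: "n = 1" and ij: "i + j < p - 1" "i + j + card (slopes K f) \<le> p"
  shows "(\<Sum>x\<in>K. x ^ i * f x ^ j) = 0"
proof -
  define k where "k = i + j"
  define S where "S = (\<Sum>x\<in>K. [:- f x, x:] ^ k)"
  have "S = 0"
  proof (rule poly_eqI_degree_lead_coeff[where n = k and A = "K - slopes K f"])
    show "coeff S k = coeff 0 k"
      using power_sum_eq_0[of k] ij(1) n by (simp add: S_def coeff_sum coeff_linear_poly_power k_def)
    have "card (K - slopes K f) = p ^ n - card (slopes K f)"
      by (simp add: card_Diff_subset slopes_subset[OF f] card_K)
    then show "k \<le> card (K - slopes K f)" using ij(2) n by (simp add: k_def)
    have "degree ([:- f x, x:] ^ k) \<le> k" for x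
      by (rule order_trans[OF degree_power_le]) simp
    then show "degree S \<le> k" unfolding S_def by (intro degree_sum_le) simp_all
    fix y assume y: "y \<in> K - slopes K f"
    have "poly S y = (\<Sum>x\<in>K. (- 1) ^ k * (f x - y * x) ^ k)"
      unfolding S_def poly_sum power_mult_distrib[symmetric]
      by (intro sum.cong refl) (simp add: algebra_simps)
    also have "\<dots> = (\<Sum>z\<in>K. (- 1) ^ k * z ^ k)"
      using sum.reindex_bij_betw[OF bij_betw_non_slope[OF f y], of "\<lambda>z. (- 1) ^ k * z ^ k"] by simp
    also have "\<dots> = 0"
      using power_sum_eq_0[of k] ij(1) n by (simp add: sum_distrib_left[symmetric] k_def)
    finally show "poly S y = poly 0 y" by simp
  qed simp
  have "coeff S i = (\<Sum>x\<in>K. of_nat (k choose i) * (- 1) ^ j * (x ^ i * f x ^ j))"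
    unfolding S_def coeff_sum by (intro sum.cong refl)
      (simp add: coeff_linear_poly_power k_def power_minus[of "f _"])
  also have "\<dots> = of_nat (k choose i) * (- 1) ^ j * (\<Sum>x\<in>K. x ^ i * f x ^ j)"
    by (simp add: sum_distrib_left)
  finally have eq: "of_nat (k choose i) * (- 1) ^ j * (\<Sum>x\<in>K. x ^ i * f x ^ j) = 0"
    using \<open>S = 0\<close> by simp
  have "\<not> p dvd (k choose i)"
  proof
    assume "p dvd (k choose i)"
    then have "p dvd fact k" by (metis binomial_fact_lemma dvd_mult k_def le_add1)
    then show False using prime_dvd_fact_iff[OF prime] ij(1) by (simp add: k_def)
  qed
  then show ?thesis using eq by (simp add: of_nat_eq_0_iff_dvd)
qed

text \<open>The coefficient at \<open>i\<close> is minus the sum of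
  \<open>x ^ (p ^ n - 1 - i) * poly P x\<close> over \<open>K\<close>. For \<open>i = 0\<close> the
  degree may be too large for \<open>sum_poly\<close>, but there the coefficient is
  \<open>poly P 0\<close>.\<close>

lemma coeff_mem:
  assumes P: "degree P < p ^ n" and K: "\<And>x. x \<in> K \<Longrightarrow> poly P x \<in> K"
  shows "coeff P i \<in> K"
proof (cases "i = 0 \<or> i \<ge> p ^ n")
  case True
  then show ?thesis using P K[of 0] by (auto simp: coeff_eq_0 poly_0_coeff_0)
next
  case False
  have "degree (monom 1 (p ^ n - 1 - i) * P) \<le> (p ^ n - 1 - i) + degree P"
    by (rule order_trans[OF degree_mult_le]) (simp add: degree_monom_eq)
  then have "degree (monom 1 (p ^ n - 1 - i) * P) < 2 * (p ^ n - 1)"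
    using False P by linarith
  then have "(\<Sum>x\<in>K. poly (monom 1 (p ^ n - 1 - i) * P) x)
      = - coeff (monom 1 (p ^ n - 1 - i) * P) (p ^ n - 1)" by (rule sum_poly)
  also have "\<dots> = - coeff P i" using False by (simp add: coeff_monom_mult)
  finally have "(\<Sum>x\<in>K. poly (monom 1 (p ^ n - 1 - i) * P) x) = - coeff P i" .
  moreover have "(\<Sum>x\<in>K. poly (monom 1 (p ^ n - 1 - i) * P) x) \<in> K"
    by (intro sum_mem) (simp add: poly_monom K)
  ultimately show ?thesis using uminus_mem[of "- coeff P i"] by simp
qed

text \<open>The vanishing sums in usable form: a polynomial of degree exactly \<open>p - 1\<close>
  cannot represent \<open>x ^ i * f x ^ j\<close> in this range.\<close>

lemma coeff_top_eq_0:
  assumes f: "f ` K \<subseteq> K" and n: "n = 1" and ij: "i + j < p - 1" "i + j + card (slopes K f) \<le> p"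
    and P: "\<And>x. x \<in> K \<Longrightarrow> poly P x = x ^ i * f x ^ j" "degree P < 2 * (p - 1)"
  shows "coeff P (p - 1) = 0"
proof -
  have "- coeff P (p - 1) = (\<Sum>x\<in>K. poly P x)" using sum_poly[of P] P(2) n by simp
  also have "\<dots> = (\<Sum>x\<in>K. x ^ i * f x ^ j)" by (intro sum.cong refl P(1))
  also have "\<dots> = 0" by (rule mixed_power_sum[OF f n ij])
  finally show ?thesis by simp
qed

text \<open>Otherwise \<open>i = p - 1 - degree P\<close> and \<open>j = 1\<close> are admissible
  exponents, although \<open>X^i P\<close> has degree exactly \<open>p - 1\<close>.\<close>

lemma degree_less_card_slopes:
  assumes f: "f ` K \<subseteq> K" and n: "n = 1"
    and P: "\<And>x. x \<in> K \<Longrightarrow> poly P x = f x" "degree P < p" "2 \<le> degree P"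
  shows "degree P < card (slopes K f)"
proof (rule ccontr)
  assume N: "\<not> degree P < card (slopes K f)"
  let ?i = "p - 1 - degree P"
  let ?Q = "monom 1 ?i * P"
  have "P \<noteq> 0" using P(3) by auto
  then have deg: "degree ?Q = p - 1" using P(2) by (simp add: degree_mult_eq degree_monom_eq monom_eq_0_iff)
  have "coeff ?Q (p - 1) = 0"
  proof (rule coeff_top_eq_0[OF f n])
    show "?i + 1 < p - 1" "?i + 1 + card (slopes K f) \<le> p" using N P by linarith+
    show "degree ?Q < 2 * (p - 1)" using deg p_gt_1 by simp
  qed (simp add: poly_monom P(1))
  then have "?Q = 0" using deg by (metis leading_coeff_0_iff)
  then show False using \<open>P \<noteq> 0\<close> by (simp add: monom_eq_0_iff)
qed

text \<open>
  For \<open>p - 1 = a d + b\<close> the polynomial \<open>X\<^sup>b P\<^sup>a\<close> has degree exactly \<open>p - 1\<close>, so its sum over \<open>K\<close> is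
  nonzero.
\<close>

lemma p_less_division_sum:
  assumes f: "f ` K \<subseteq> K" and n: "n = 1"
    and P: "\<And>x. x \<in> K \<Longrightarrow> poly P x = f x" "degree P < p" "2 \<le> degree P"
  shows "p < (p - 1) div degree P + (p - 1) mod degree P + card (slopes K f)"
proof (rule ccontr)
  let ?a = "(p - 1) div degree P" and ?b = "(p - 1) mod degree P"
  assume N: "\<not> p < ?a + ?b + card (slopes K f)"
  let ?Q = "monom 1 ?b * P ^ ?a"
  have "P \<noteq> 0" using P(3) by auto
  then have deg: "degree ?Q = p - 1"
    by (simp add: degree_mult_eq degree_monom_eq degree_power_eq monom_eq_0_iff)
  have "coeff ?Q (p - 1) = 0"
  proof (rule coeff_top_eq_0[OF f n])
    have "degree P < card (slopes K f)" by (rule degree_less_card_slopes[OF f n P])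
    then show "?b + ?a < p - 1" "?b + ?a + card (slopes K f) \<le> p" using N P(3) by linarith+
    show "degree ?Q < 2 * (p - 1)" using deg p_gt_1 by simp
  qed (simp add: poly_monom P(1))
  then have "?Q = 0" using deg by (metis leading_coeff_0_iff)
  then show False using \<open>P \<noteq> 0\<close> by (simp add: monom_eq_0_iff)
qed

lemma interpolate_nonaffine:
  assumes "\<not> affine_fun K f"
  obtains P where "degree P < p ^ n" "\<And>x. x \<in> K \<Longrightarrow> poly P x = f x" "2 \<le> degree P"
proof -
  obtain P where P: "degree P < p ^ n" "\<And>x. x \<in> K \<Longrightarrow> poly P x = f x"
    by (rule interpolate[of f], rule that)
  have "2 \<le> degree P"
  proof (rule ccontr)
    assume "\<not> 2 \<le> degree P"
    then have "P = [:coeff P 0, coeff P 1:]"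
      by (intro poly_eqI) (auto simp: coeff_pCons coeff_eq_0 split: nat.split)
    then have "poly P x = coeff P 1 * x + coeff P 0" for x
      by (metis add.commute add.right_neutral mult.commute mult_zero_right poly_0 poly_pCons)
    then show False using P(2) assms unfolding affine_fun_def by metis
  qed
  with P that show ?thesis by blast
qed

lemma two_neq_0:
  assumes "odd p" shows "(2 :: 'a) \<noteq> 0"
proof
  assume "(2 :: 'a) = 0"
  then have "of_nat 2 = (0 :: 'a)" by simp
  then have "p dvd 2" by (simp only: of_nat_eq_0_iff_dvd)
  then show False using assms p_gt_1 dvd_imp_le[of p 2] by (cases "p = 2") auto
qed

text \<open>The slope between \<open>x\<close> and \<open>y\<close> is
  \<open>a * (x + y) + b\<close>, and each element of \<open>K\<close> is a sum of two distinct
  ones: \<open>u + 0\<close>, or \<open>1 + (- 1)\<close> when \<open>u = 0\<close>.\<close>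

lemma card_slopes_quadratic:
  assumes f: "f ` K \<subseteq> K" and "odd p"
    and P: "\<And>x. x \<in> K \<Longrightarrow> poly P x = f x" "degree P < p ^ n" "degree P = 2"
  shows "card (slopes K f) = p ^ n"
proof -
  define a b c where "a = coeff P 2" and "b = coeff P 1" and "c = coeff P 0"
  have "poly P x \<in> K" if "x \<in> K" for x using P(1) f that by auto
  then have mem: "a \<in> K" "b \<in> K" using coeff_mem[OF P(2)] by (auto simp: a_def b_def)
  have a: "a \<noteq> 0" using P(3) unfolding a_def by (metis degree_0 leading_coeff_0_iff zero_neq_numeral)
  have fx: "f x = a * x\<^sup>2 + b * x + c" if "x \<in> K" for x
    using P(1)[OF that] P(3) by (simp add: poly_altdef a_def b_def c_def numeral_2_eq_2 algebra_simps)
  have "(1 :: 'a) \<noteq> - 1"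
    using two_neq_0[OF \<open>odd p\<close>] by (simp add: eq_neg_iff_add_eq_0)
  have "K \<subseteq> slopes K f"
  proof
    fix s assume s: "s \<in> K"
    define u where "u = (s - b) / a"
    have u: "u \<in> K" using s mem by (simp add: u_def)
    have slope: "s \<in> slopes K f" if "x \<in> K" "y \<in> K" "x \<noteq> y" "x + y = u" for x y
    proof -
      have "f x - f y = (x - y) * (a * (x + y) + b)"
        using that(1,2) by (simp add: fx power2_eq_square algebra_simps)
      also have "a * (x + y) + b = s" using a by (simp add: that(4) u_def)
      finally have "(f x - f y) / (x - y) = s" using that(3) by simp
      then show ?thesis using slopesI[OF that(1-3), of f] by simp
    qed
    show "s \<in> slopes K f"
    proof (cases "u = 0")
      case True
      then show ?thesis using slope[of 1 "- 1"] \<open>(1 :: 'a) \<noteq> - 1\<close> by simp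
    next
      case False
      then show ?thesis using slope[of u 0] u by simp
    qed
  qed
  then show ?thesis using slopes_subset[OF f] card_K by (metis subset_antisym)
qed

text \<open>By parity the negation gives \<open>2 * N \<le> p + 1\<close>. With
  \<open>p - 1 = a * d + b\<close> the two degree bounds yield \<open>a \<ge> 2\<close> and
  \<open>a * (d - 2) < b < d\<close>, impossible for \<open>d \<ge> 3\<close>; for
  \<open>d = 2\<close> the remainder \<open>b\<close> is 0 since \<open>p\<close> is odd.\<close>

lemma card_slopes_prime:
  assumes f: "f ` K \<subseteq> K" and "\<not> affine_fun K f" and n: "n = 1" and "odd p"
  shows "p + 3 \<le> 2 * card (slopes K f)"
proof (rule ccontr)
  assume "\<not> ?thesis"
  moreover have "even (p + 3)" using \<open>odd p\<close> by simp
  ultimately have N: "2 * card (slopes K f) \<le> p + 1" by presburger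
  obtain P where P: "degree P < p ^ n" "\<And>x. x \<in> K \<Longrightarrow> poly P x = f x" "2 \<le> degree P"
    by (rule interpolate_nonaffine[OF assms(2)], rule that)
  define d where "d = degree P"
  define a b where "a = (p - 1) div d" and "b = (p - 1) mod d"
  have d: "2 \<le> d" "d < p" using P n by (auto simp: d_def)
  have "d < card (slopes K f)"
    unfolding d_def using P n by (intro degree_less_card_slopes[OF f n]) auto
  then have d2: "2 * d \<le> p - 1" using N by linarith
  have "p < a + b + card (slopes K f)"
    unfolding a_def b_def d_def using P n by (intro p_less_division_sum[OF f n]) auto
  then have less: "p - 1 < 2 * (a + b)" using N p_gt_1 by simp
  have ab: "a * d + b = p - 1" "b < d" using d by (auto simp: a_def b_def)
  have a2: "2 \<le> a" using d2 d unfolding a_def by (simp add: less_eq_div_iff_mult_less_eq)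
  show False
  proof (cases "d = 2")
    case True
    have "even (p - 1)" using \<open>odd p\<close> by simp
    then have "b = 0" using True by (simp add: b_def even_iff_mod_2_eq_zero)
    then show False using ab less True by simp
  next
    case False
    then obtain d' where d': "d = d' + 3" using d(1) by (metis add.commute le_Suc_ex le_antisym not_less_eq_eq numeral_2_eq_2 numeral_3_eq_3)
    have "2 * (d' + 1) \<le> a * (d' + 1)" using a2 by (rule mult_right_mono) simp
    then show False using ab less by (simp add: d' algebra_simps)
  qed
qed

text \<open>As in the lower bound, but with slack 2: a smaller degree gives \<open>a \<ge> 2\<close>
  and \<open>a * (d - 2) < b + 2\<close>, impossible for \<open>d \<ge> 5\<close>. Degree 2 has too
  many slopes, and degrees 3 and 4 leave only composite values of \<open>p\<close>.\<close>

lemma degree_extremal_prime: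
  assumes f: "f ` K \<subseteq> K" and n: "n = 1" and "odd p" and N: "2 * card (slopes K f) = p + 3"
    and P: "\<And>x. x \<in> K \<Longrightarrow> poly P x = f x" "degree P < p" "2 \<le> degree P"
  shows "2 * degree P = p + 1"
proof (rule ccontr)
  assume neq: "2 * degree P \<noteq> p + 1"
  define d where "d = degree P"
  define a b where "a = (p - 1) div d" and "b = (p - 1) mod d"
  have d: "2 \<le> d" "d < p" using P by (auto simp: d_def)
  have "d < card (slopes K f)" unfolding d_def by (intro degree_less_card_slopes[OF f n P])
  then have "2 * d < p + 1" using N neq by (simp add: d_def)
  moreover have "even (p + 1)" using \<open>odd p\<close> by simp
  ultimately have d2: "2 * d \<le> p - 1" by presburger
  have "p < a + b + card (slopes K f)"
    unfolding a_def b_def d_def by (intro p_less_division_sum[OF f n P])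
  then have less: "p < 2 * (a + b) + 3" using N by simp
  have ab: "a * d + b = p - 1" "b < d" using d by (auto simp: a_def b_def)
  then have p: "p = a * d + b + 1" using p_gt_1 by linarith
  have a2: "2 \<le> a" using d2 d unfolding a_def by (simp add: less_eq_div_iff_mult_less_eq)
  consider "d = 2" | "d = 3" | "d = 4" | "5 \<le> d" using d(1) by linarith
  then show False
  proof cases
    case 1
    have "card (slopes K f) = p"
      using card_slopes_quadratic[OF f \<open>odd p\<close>, of P] P n 1 by (simp add: d_def)
    then show False using N d2 1 by simp
  next
    case 2
    then have "p = a * 3 + b + 1" using p by simp
    then have "a < b + 2" "b \<le> 2" using less ab(2) 2 by simp_all
    \<comment> \<open>The three cases give \<open>p = 8\<close>, \<open>p = 9\<close> and
      \<open>p = 12\<close>.\<close>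
    then consider "b = 1" "a = 2" | "b = 2" "a = 2" | "b = 2" "a = 3" using a2 by linarith
    then show False
    proof cases
      case 2
      then have "p = 3 * 3" using p \<open>d = 3\<close> by simp
      then show False using prime prime_product[of 3 3] by simp
    qed (use p \<open>d = 3\<close> \<open>odd p\<close> in simp_all)
  next
    case 3
    then have "p = a * 4 + b + 1" using p by simp
    then have "2 * a < b + 2" "b \<le> 3" using less ab(2) 3 by simp_all
    then have "a = 2" "b = 3" using a2 by linarith+
    then show False using p 3 \<open>odd p\<close> by simp
  next
    case 4
    then obtain d' where d': "d = d' + 5" by (metis add.commute le_Suc_ex)
    have "2 * (d' + 3) \<le> a * (d' + 3)" using a2 by (rule mult_right_mono) simp
    then show False using p less ab(2) by (simp add: d' algebra_simps)
  qed
qed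

text \<open>The degree is \<open>d = (p + 1) div 2\<close>. Completing the \<open>d\<close>-th power
  and removing an affine part leaves a remainder \<open>H\<close> of degree at most
  \<open>d - 2\<close>; a nonzero \<open>H\<close> would violate a vanishing sum that is quadratic
  in \<open>f\<close>.\<close>

lemma extremal_prime_polynomial:
  assumes f: "f ` K \<subseteq> K" and "\<not> affine_fun K f" and n: "n = 1" and "odd p"
    and N: "2 * card (slopes K f) = p + 3"
  obtains c x0 b b' where "c \<in> K" "c \<noteq> 0" "x0 \<in> K" "b \<in> K"
    "\<And>x. x \<in> K \<Longrightarrow> f x = c * (x - x0) ^ ((p + 1) div 2) + b * x + b'"
proof -
  obtain P where P: "degree P < p ^ n" "\<And>x. x \<in> K \<Longrightarrow> poly P x = f x" "2 \<le> degree P"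
    by (rule interpolate_nonaffine[OF assms(2)], rule that)
  have P_mem: "coeff P i \<in> K" for i using P(1,2) f by (intro coeff_mem) auto
  define d where "d = degree P"
  have d: "2 * d = p + 1" "d \<ge> 2"
    using degree_extremal_prime[OF f n \<open>odd p\<close> N P(2)] P n by (auto simp: d_def)
  define c where "c = coeff P d"
  have c: "c \<in> K" "c \<noteq> 0" using P_mem P(3) by (auto simp: c_def d_def)
  have "\<not> p dvd d" using d by (intro notI) (auto dest!: dvd_imp_le)
  then have d_nz: "of_nat d \<noteq> (0 :: 'a)" by (simp add: of_nat_eq_0_iff_dvd)
  \<comment> \<open>This \<open>x0\<close> makes the coefficients at \<open>X^(d-1)\<close> of
    \<open>P\<close> and \<open>c (X - x0)^d\<close> agree; \<open>d\<close> is invertible because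
    \<open>p\<close> does not divide it.\<close>
  define x0 where "x0 = - coeff P (d - 1) / (of_nat d * c)"
  have x0: "x0 \<in> K" using P_mem c by (simp add: x0_def)
  let ?A = "[:- x0, 1:] ^ d"
  have degA: "degree ?A = d" by (simp add: degree_linear_power)
  define G where "G = P - smult c ?A"
  have G_coeff: "coeff G i = 0" if i: "i \<ge> d - 1" for i
  proof -
    consider "i = d - 1" | "i = d" | "i > d" using i by linarith
    then show ?thesis
    proof cases
      case 1
      have "d choose (d - 1) = d" using d(2) by (subst binomial_symmetric) simp_all
      then have "coeff ?A (d - 1) = of_nat d * (- x0)"
        using d(2) by (simp add: coeff_linear_poly_power)
      then show ?thesis using d_nz c 1 by (simp add: G_def x0_def)
    next
      case 2
      then show ?thesis using coeff_linear_power[of "- x0" d] by (simp add: G_def c_def)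
    next
      case 3
      then show ?thesis using degA by (simp add: G_def coeff_eq_0 d_def)
    qed
  qed
  have f_eq: "f x = c * (x - x0) ^ d + poly G x" if "x \<in> K" for x
    using P(2)[OF that] by (simp add: G_def)
  define b b' where "b = coeff G 1" and "b' = coeff G 0"
  define H where "H = G - [:b', b:]"
  have "poly G x \<in> K" if "x \<in> K" for x
  proof -
    have "poly G x = f x - c * (x - x0) ^ d" using f_eq[OF that] by simp
    then show ?thesis using f c x0 that by (auto simp: image_subset_iff)
  qed
  moreover have "degree G < p ^ n"
  proof -
    have "degree G \<le> d" unfolding G_def using degA by (intro degree_diff_le) (auto simp: d_def)
    then show ?thesis using P(1) by (simp add: d_def)
  qed
  ultimately have G_mem: "coeff G i \<in> K" for i by (intro coeff_mem)
  then have b: "b \<in> K" "b' \<in> K" by (simp_all add: b_def b'_def)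
  have f_eq': "f x = c * (x - x0) ^ d + b * x + b' + poly H x" if "x \<in> K" for x
    using f_eq[OF that] by (simp add: H_def algebra_simps)
  have "H = 0"
  proof (rule ccontr)
    assume "H \<noteq> 0"
    define t where "t = degree H"
    have H_lead: "coeff H t \<noteq> 0" using \<open>H \<noteq> 0\<close> by (simp add: t_def)
    have "coeff H 0 = 0" "coeff H 1 = 0" by (simp_all add: H_def b_def b'_def)
    then have t2: "2 \<le> t" using H_lead by (cases t; cases "t - 1") auto
    then have "coeff G t = coeff H t" by (auto simp: H_def coeff_pCons split: nat.split)
    then have td: "t + 2 \<le> d" using G_coeff[of t] H_lead t2 by force
    define g where "g = (\<lambda>x. f x - b * x - b')"
    \<comment> \<open>Since \<open>2 * d = p + 1\<close>, this choice gives the mixed term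
      \<open>X^i (X - x0)^d H\<close> degree exactly \<open>p - 1\<close>.\<close>
    define i where "i = d - 2 - t"
    have i: "i + d + t = p - 1" using td d by (simp add: i_def)
    define T where "T = monom 1 i * (smult (c\<^sup>2) ([:- x0, 1:]\<^sup>2) + smult (2 * c) (?A * H) + H\<^sup>2)"
    have T_eq: "T = smult (c\<^sup>2) (monom 1 i * [:- x0, 1:]\<^sup>2) + smult (2 * c) (monom 1 i * (?A * H)) + monom 1 i * H\<^sup>2"
      by (simp add: T_def algebra_simps)
    have deg1: "degree (monom 1 i * [:- x0, 1:]\<^sup>2) = i + 2"
      by (simp add: degree_mult_eq degree_monom_eq monom_eq_0_iff degree_linear_power del: power2_eq_square)
    have deg2: "degree (monom 1 i * (?A * H)) = p - 1"
      using \<open>H \<noteq> 0\<close> i degA by (simp add: degree_mult_eq degree_monom_eq monom_eq_0_iff t_def)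
    have deg3: "degree (monom 1 i * H\<^sup>2) = i + 2 * t"
      using \<open>H \<noteq> 0\<close>
      by (subst degree_mult_eq) (simp_all add: degree_monom_eq monom_eq_0_iff t_def degree_power_eq)
    \<comment> \<open>Only the mixed term of \<open>(c (x - x\<^sub>0)\<^sup>d + H)\<^sup>2\<close> reaches degree \<open>p - 1\<close>, since \<open>(x - x\<^sub>0)\<^bsup>2d\<^esup> = (x - x\<^sub>0)\<^sup>2\<close> on \<open>K\<close>.\<close>
    have coeff_T: "coeff T (p - 1) = 2 * c * coeff H t"
    proof -
      have "coeff (monom 1 i * (?A * H)) (p - 1) = lead_coeff (monom 1 i * (?A * H))"
        by (simp only: deg2)
      also have "\<dots> = coeff H t"
        by (simp add: lead_coeff_mult lead_coeff_power t_def degree_monom_eq)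
      finally show ?thesis
        using deg1 deg3 i td t2 unfolding T_eq by (simp add: coeff_eq_0)
    qed
    have "coeff T (p - 1) = 0"
    proof (rule coeff_top_eq_0[where f = g and i = i and j = 2])
      show "g ` K \<subseteq> K" using f b by (auto simp: g_def image_subset_iff)
      have "card (slopes K g) = card (slopes K f)" unfolding g_def by (rule card_slopes_shift)
      \<comment> \<open>Here \<open>N = d + 1\<close>, so \<open>i + 2 + N = p + 2 - t\<close>:
        removing the affine part, which gives \<open>t \<ge> 2\<close>, is just enough.\<close>
      then show "i + 2 + card (slopes K g) \<le> p" "i + 2 < p - 1" using N d i t2 td by linarith+
      have "degree T \<le> p - 1"
        unfolding T_eq using deg1 deg2 deg3 i td t2
        by (intro degree_add_le order_trans[OF degree_smult_le]) linarith+
      then show "degree T < 2 * (p - 1)" using p_gt_1 by simp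
      fix x assume x: "x \<in> K"
      let ?y = "(x - x0) ^ d"
      have "(x - x0) ^ (2 * d) = (x - x0) ^ (p ^ n) * (x - x0)" using n by (simp add: d(1))
      also have "\<dots> = (x - x0)\<^sup>2" using x x0 by (simp add: power_card power2_eq_square)
      finally have y2: "?y\<^sup>2 = (x - x0)\<^sup>2" by (simp add: power_mult[symmetric] mult.commute)
      have "g x = c * ?y + poly H x" using f_eq'[OF x] by (simp add: g_def)
      then have "(g x)\<^sup>2 = c\<^sup>2 * ?y\<^sup>2 + 2 * c * (?y * poly H x) + (poly H x)\<^sup>2"
        by (simp add: power2_eq_square algebra_simps)
      then show "poly T x = x ^ i * (g x)\<^sup>2"
        unfolding y2 by (simp add: T_def poly_monom)
    qed (use n in simp)
    then show False using coeff_T c H_lead two_neq_0[OF \<open>odd p\<close>] by simp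
  qed
  moreover have "(p + 1) div 2 = d" using d by simp
  ultimately show ?thesis
    using that[of c x0 b b'] c x0 b f_eq' by simp
qed

section \<open>Slopes under affine changes of the function\<close>

lemma slopes_translate:
  assumes "a \<in> K" shows "slopes K (\<lambda>x. f (x - a)) = slopes K f"
proof -
  have sub: "slopes K (\<lambda>x. g (x - a)) \<subseteq> slopes K g" if "a \<in> K" for a g
  proof
    fix s assume "s \<in> slopes K (\<lambda>x. g (x - a))"
    then obtain x y where xy: "x \<in> K" "y \<in> K" "x \<noteq> y" "s = (g (x - a) - g (y - a)) / (x - y)"
      by (auto simp: slopes_def)
    then show "s \<in> slopes K g"
      using slopesI[of "x - a" K "y - a" g] that by simp
  qed
  show ?thesis using sub[OF assms, of f] sub[of "- a" "\<lambda>x. f (x - a)"] assms by auto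
qed

lemma slopes_smult: "slopes K (\<lambda>x. c * f x) = (\<lambda>s. c * s) ` slopes K f"
  unfolding slopes_eq_image image_image
  by (intro image_cong refl) (auto simp: right_diff_distrib)

lemma slopes_cong: "(\<And>x. x \<in> K \<Longrightarrow> f x = g x) \<Longrightarrow> slopes K f = slopes K g"
  unfolding slopes_eq_image by (intro image_cong refl) auto

lemma slopes_extremal_prime:
  assumes f: "f ` K \<subseteq> K" and "\<not> affine_fun K f" and n: "n = 1" and "odd p"
    and N: "2 * card (slopes K f) = p + 3"
  obtains c b where "c \<in> K" "c \<noteq> 0" "b \<in> K"
    "slopes K f = (\<lambda>s. c * s + b) ` slopes K (\<lambda>x. x ^ ((p + 1) div 2))"
proof -
  obtain c x0 b b' where cb: "c \<in> K" "c \<noteq> 0" "x0 \<in> K" "b \<in> K"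
    "\<And>x. x \<in> K \<Longrightarrow> f x = c * (x - x0) ^ ((p + 1) div 2) + b * x + b'"
    by (rule extremal_prime_polynomial[OF assms], rule that)
  have "slopes K f = slopes K (\<lambda>x. c * (x - x0) ^ ((p + 1) div 2) + b * x + b')"
    by (rule slopes_cong) (rule cb(5))
  also have "\<dots> = (\<lambda>s. c * s + b) ` slopes K (\<lambda>x. x ^ ((p + 1) div 2))"
    using slopes_translate[OF cb(3), of "\<lambda>x. x ^ ((p + 1) div 2)"]
    by (simp add: slopes_add_linear slopes_smult image_image)
  finally show ?thesis using that cb by blast
qed

section \<open>Functions with few slopes\<close>

lemma not_affine_poly:
  assumes "\<And>x. x \<in> K \<Longrightarrow> poly P x = f x" "degree P < p ^ n" "2 \<le> degree P"
  shows "\<not> affine_fun K f"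
proof
  assume "affine_fun K f"
  then obtain a b where ab: "\<forall>x\<in>K. f x = a * x + b" by (auto simp: affine_fun_def)
  have "P = [:b, a:]"
  proof (rule poly_eqI_degree[where A = K])
    show "poly P x = poly [:b, a:] x" if "x \<in> K" for x
      using assms(1)[OF that] ab that by (simp add: mult.commute add.commute)
    show "degree P < card K" "degree [:b, a:] < card K" using assms(2,3) p_gt_1 by (auto simp: card_K)
  qed
  then show False using assms(3) by (simp split: if_splits)
qed

text \<open>On \<open>K\<close> the function is \<open>x\<close> times its quadratic character.
  Arguments of equal character, or one equal to 0, give slopes 1 and -1; mixed pairs give
  \<open>(t + 1) / (t - 1)\<close> with \<open>t = x / y\<close> a root of \<open>t^h = -1\<close>.
  Together these are at most \<open>2 + (p - 1) div 2\<close> values.\<close>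

lemma power_example:
  assumes n: "n = 1" and "odd p"
  defines "f \<equiv> \<lambda>x :: 'a. x ^ ((p + 1) div 2)"
  shows "f ` K \<subseteq> K" "\<not> affine_fun K f" "card (slopes K f) \<le> (p + 3) div 2"
proof -
  show "f ` K \<subseteq> K" by (auto simp: f_def)
  obtain h where h: "p = 2 * h + 1" using \<open>odd p\<close> by (rule oddE)
  have h1: "h \<ge> 1" using h p_gt_1 by simp
  have f: "f x = x * x ^ h" for x by (simp add: f_def h)
  show "\<not> affine_fun K f"
  proof (rule not_affine_poly)
    show "poly (monom 1 (Suc h)) x = f x" for x by (simp add: poly_monom f)
    show "degree (monom (1 :: 'a) (Suc h)) < p ^ n" "2 \<le> degree (monom (1 :: 'a) (Suc h))"
      using h1 n h by (simp_all add: degree_monom_eq)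
  qed
  have h_power: "x ^ h = 1 \<or> x ^ h = - 1" if "x \<in> K" "x \<noteq> 0" for x
  proof -
    have "(x ^ h)\<^sup>2 = x ^ (p ^ n - 1)" using n by (simp add: h power_mult[symmetric] mult.commute)
    also have "\<dots> = 1" by (rule power_card_minus_1[OF that])
    finally show ?thesis by (simp add: power2_eq_1_iff)
  qed
  define M where "M = {t :: 'a. t ^ h = - 1}"
  let ?B = "{1, - 1} \<union> (\<lambda>t. (t + 1) / (t - 1)) ` M"
  have mixed: "(x + y) / (x - y) \<in> ?B" if "x \<noteq> 0" "y \<noteq> 0" "x ^ h = 1" "y ^ h = - 1" for x y :: 'a
  proof -
    have "x / y \<in> M" using that by (simp add: M_def power_divide)
    moreover have "(x + y) / (x - y) = (x / y + 1) / (x / y - 1)"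
    proof -
      have "x / y + 1 = (x + y) / y" "x / y - 1 = (x - y) / y"
        using that(2) by (simp_all add: add_divide_distrib diff_divide_distrib)
      then show ?thesis using that(2) by simp
    qed
    ultimately show ?thesis by blast
  qed
  have "slopes K f \<subseteq> ?B"
  proof
    fix s assume "s \<in> slopes K f"
    then obtain x y where xy: "x \<in> K" "y \<in> K" "x \<noteq> y" "s = (f x - f y) / (x - y)"
      by (auto simp: slopes_def)
    show "s \<in> ?B"
    proof (cases "x = 0 \<or> y = 0")
      case True
      then have "s = y ^ h \<and> y \<noteq> 0 \<or> s = x ^ h \<and> x \<noteq> 0"
        using xy(3) unfolding xy(4) f by auto
      then show ?thesis using h_power[OF xy(1)] h_power[OF xy(2)] by auto
    next
      case False
      then consider "x ^ h = y ^ h" | "x ^ h = 1" "y ^ h = - 1" | "x ^ h = - 1" "y ^ h = 1"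
        using h_power xy by metis
      then show ?thesis
      proof cases
        case 1
        then have "f x - f y = x ^ h * (x - y)" by (simp add: f algebra_simps)
        then have "s = x ^ h" using xy by simp
        then show ?thesis using h_power[of x] False xy by auto
      next
        case 2
        then show ?thesis using mixed[of x y] False xy(4) by (simp add: f)
      next
        case 3
        have "s = (y + x) / (y - x)"
        proof -
          have "f x - f y = - (y + x)" using 3 by (simp add: f)
          moreover have "x - y = - (y - x)" by simp
          ultimately show ?thesis unfolding xy(4) by (metis minus_divide_divide)
        qed
        then show ?thesis using mixed[of y x] False 3 by simp
      qed
    qed
  qed
  then have "card (slopes K f) \<le> card ?B" by (intro card_mono) auto
  also have "\<dots> \<le> card {1, - 1 :: 'a} + card ((\<lambda>t. (t + 1) / (t - 1)) ` M)" by (rule card_Un_le)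
  also have "\<dots> \<le> 2 + card M"
    by (intro add_mono card_image_le) (auto simp: card_insert_if)
  also have "card M \<le> h"
  proof -
    let ?P = "monom 1 h + 1 :: 'a poly"
    have "coeff ?P h = 1" using h1 by (simp add: coeff_eq_0)
    then have "?P \<noteq> 0" by (intro notI) (simp only: coeff_0 zero_neq_one)
    then have "card {t. poly ?P t = 0} \<le> degree ?P" by (rule card_poly_roots_bound)
    also have "\<dots> \<le> h" by (intro degree_add_le) (auto simp: degree_monom_eq)
    also have "{t. poly ?P t = 0} = M" by (auto simp: M_def poly_monom eq_neg_iff_add_eq_0)
    finally show ?thesis .
  qed
  finally show "card (slopes K f) \<le> (p + 3) div 2" by (simp add: h)
qed

text \<open>\<open>f\<close> is the trace from \<open>K\<close> onto its subfield of order
  \<open>p ^ k\<close>. By additivity slopes have the form \<open>f z / z\<close>; a nonzero one is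
  \<open>1 / u\<close> with \<open>u = z / f z\<close> and \<open>f u = 1\<close>, an equation of
  degree \<open>p ^ (n - k)\<close>.\<close>

lemma trace_example:
  assumes k: "k dvd n" "k < n"
  defines "f \<equiv> \<lambda>x :: 'a. \<Sum>j<n div k. x ^ p ^ (k * j)"
  shows "f ` K \<subseteq> K" "\<not> affine_fun K f" "card (slopes K f) \<le> p ^ (n - k) + 1"
proof -
  have k1: "k \<ge> 1" using k n_pos by (cases k) auto
  define r where "r = n div k"
  have nr: "n = k * r" using k by (simp add: r_def)
  have r2: "r \<ge> 2" using k k1 unfolding nr by (cases r; cases "r - 1") auto
  have nk: "n - k = k * (r - 1)" by (simp add: nr diff_mult_distrib2)
  have f_sum: "f x = (\<Sum>j<r. x ^ p ^ (k * j))" for x by (simp add: f_def r_def)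
  show fK: "f ` K \<subseteq> K" by (auto simp: f_def intro!: sum_mem)
  define P where "P = (\<Sum>j<r. monom (1 :: 'a) (p ^ (k * j)))"
  have poly_P: "poly P x = f x" for x by (simp add: P_def poly_sum poly_monom f_sum)
  have le: "p ^ (k * j) \<le> p ^ (n - k)" if "j < r" for j
    unfolding nk using that p_gt_1 by (intro power_increasing) auto
  have "coeff P (p ^ (n - k)) = (\<Sum>j<r. if j = r - 1 then 1 else 0)"
    unfolding P_def coeff_sum nk using p_gt_1 k1 by (intro sum.cong refl) auto
  also have "\<dots> = 1" using r2 by simp
  finally have top: "coeff P (p ^ (n - k)) = 1" .
  have "degree P \<le> p ^ (n - k)"
    unfolding P_def using le by (intro degree_sum_le) (auto simp: degree_monom_eq)
  moreover have "p ^ (n - k) \<le> degree P" using top by (intro le_degree) simp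
  ultimately have degP: "degree P = p ^ (n - k)" by simp
  have pnk: "2 \<le> p ^ (n - k)" using k by (intro power_p_ge_2) simp
  show "\<not> affine_fun K f"
  proof (rule not_affine_poly)
    show "degree P < p ^ n" unfolding degP using p_gt_1 k k1 by (intro power_strict_increasing) auto
  qed (use degP pnk poly_P in auto)
  have f_fixed: "f x ^ p ^ k = f x" if "x \<in> K" for x
  proof -
    have "f x ^ p ^ k = (\<Sum>j<r. (x ^ p ^ (k * j)) ^ p ^ k)"
      unfolding f_sum by (rule freshmans_dream_sum'[where n = k]) (simp_all only: char prime)
    also have "\<dots> = (\<Sum>j<r. x ^ p ^ (k * Suc j))"
      by (intro sum.cong refl) (simp add: power_mult[symmetric] power_add[symmetric] add.commute)
    \<comment> \<open>The Frobenius power shifts the sum by one index; the new last term is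
      \<open>x ^ p ^ n = x\<close>, so the shift is cyclic.\<close>
    finally have "f x ^ p ^ k + x = (\<Sum>j<Suc r. x ^ p ^ (k * j))"
      by (simp add: sum.lessThan_Suc_shift del: sum.lessThan_Suc)
    also have "\<dots> = f x + x" using power_card[OF that] by (simp add: f_sum nr)
    finally show ?thesis by simp
  qed
  have fixed_iter: "c ^ p ^ (k * j) = c" if "c ^ p ^ k = c" for c :: 'a and j
    using that by (induction j) (simp_all add: power_add power_mult)
  have f_diff: "f (x - y) = f x - f y" for x y
    by (simp add: f_sum frobenius_diff sum_subtractf)
  let ?U = "{u. f u = 1}"
  have "slopes K f \<subseteq> insert 0 ((\<lambda>u. 1 / u) ` ?U)"
  proof
    fix s assume "s \<in> slopes K f"
    then obtain x y where xy: "x \<in> K" "y \<in> K" "x \<noteq> y" "s = (f x - f y) / (x - y)"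
      by (auto simp: slopes_def)
    define z where "z = x - y"
    have z: "z \<in> K" "z \<noteq> 0" "s = f z / z" using xy by (auto simp: z_def f_diff)
    show "s \<in> insert 0 ((\<lambda>u. 1 / u) ` ?U)"
    proof (cases "f z = 0")
      case False
      \<comment> \<open>\<open>f z\<close> is fixed by all the powers occurring in \<open>f\<close>,
        so it can be pulled out as a scalar.\<close>
      have "f (z / f z) = f z / f z"
        unfolding f_sum[of "z / f z"] power_divide
        using fixed_iter[OF f_fixed[OF z(1)]] by (simp add: sum_divide_distrib[symmetric] f_sum[symmetric])
      then have "z / f z \<in> ?U" using False by simp
      moreover have "s = 1 / (z / f z)" using z by simp
      ultimately show ?thesis by blast
    qed (use z in simp)
  qed
  then have "card (slopes K f) \<le> card (insert 0 ((\<lambda>u. 1 / u) ` ?U))" by (intro card_mono) auto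
  also have "\<dots> \<le> Suc (card ((\<lambda>u. 1 / u) ` ?U))" by (rule card_insert_le_m1) auto
  also have "\<dots> \<le> Suc (card ?U)" by (simp add: card_image_le)
  also have "card ?U \<le> p ^ (n - k)"
  proof -
    have "coeff (P - 1) (p ^ (n - k)) \<noteq> 0" using top pnk p_gt_1 by (simp add: coeff_eq_0)
    then have "P - 1 \<noteq> 0" by (intro notI) (simp only: coeff_0 simp_thms)
    then have "card {u. poly (P - 1) u = 0} \<le> degree (P - 1)" by (rule card_poly_roots_bound)
    also have "\<dots> \<le> p ^ (n - k)" by (intro degree_diff_le) (auto simp: degP)
    finally show ?thesis by (simp add: poly_P)
  qed
  finally show "card (slopes K f) \<le> p ^ (n - k) + 1" by simp
qed

end

section \<open>Cliques as graphs of functions\<close>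

lemma is_clique_Cay: "is_clique (Cay S) C \<longleftrightarrow> (\<forall>u\<in>C. \<forall>v\<in>C. u \<noteq> v \<longrightarrow> u - v \<in> S)"
  by (auto simp: is_clique_def Cay_def with_proj_def pairwise_def arcs_ends_def arc_to_ends_def)

lemma digraph_iso_Cay:
  assumes bij: "bij \<phi>" and edges: "\<And>u v. u - v \<in> S \<longleftrightarrow> \<phi> u - \<phi> v \<in> S'"
  shows "digraph_iso (Cay S) (Cay S')"
  unfolding digraph_iso_def
proof (intro exI conjI)
  let ?h = "\<lparr>iso_verts = \<phi>, iso_arcs = map_prod \<phi> \<phi>, iso_head = snd, iso_tail = fst\<rparr>"
  have inj: "inj \<phi>" and surj: "surj \<phi>" using bij by (simp_all add: bij_def)
  have "wf_digraph (Cay S)" by unfold_locales (simp_all add: Cay_def with_proj_def)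
  moreover have "inj_on (map_prod \<phi> \<phi>) A" for A
    using prod.inj_map[OF inj inj] by (rule inj_on_subset) simp
  ultimately show "pre_digraph.digraph_isomorphism (Cay S) ?h"
    using inj by (simp add: pre_digraph.digraph_isomorphism_def Cay_def with_proj_def)
  have "map_prod \<phi> \<phi> ` {(g, h). g - h \<in> S} = {(g, h). g - h \<in> S'}"
  proof (intro subset_antisym subsetI)
    fix e assume "e \<in> {(g, h). g - h \<in> S'}"
    then obtain g h where e: "e = (g, h)" "g - h \<in> S'" by auto
    obtain u v where "g = \<phi> u" "h = \<phi> v" using surj by (meson surjD)
    then show "e \<in> map_prod \<phi> \<phi> ` {(g, h). g - h \<in> S}"
      using e edges[of u v] by (intro image_eqI[of _ _ "(u, v)"]) auto
  qed (use edges in auto)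
  then show "Cay S' = app_iso ?h (Cay S)"
    using surj by (simp add: app_iso_def Cay_def with_proj_def)
qed

section \<open>Coordinates with respect to a basis over \<open>K\<close>\<close>

locale quadratic_extension = char_subfield +
  assumes card_UNIV: "CARD('a) = (p ^ n)\<^sup>2"
begin

text \<open>Linear independence over \<open>K\<close>; as the field has \<open>q^2\<close> elements,
  such a pair is a basis.\<close>

definition independent :: "'a \<Rightarrow> 'a \<Rightarrow> bool" where
  "independent v w \<longleftrightarrow> (\<forall>x\<in>K. \<forall>y\<in>K. x * v + y * w = 0 \<longrightarrow> x = 0 \<and> y = 0)"

abbreviation cosets :: "'a set set" where
  "cosets \<equiv> unit_coset K ` (UNIV - {0})"

lemma unit_coset_scale:
  assumes "k \<in> K" "k \<noteq> 0" shows "unit_coset K (k * z) = unit_coset K z"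
proof -
  have sub: "unit_coset K (k * z) \<subseteq> unit_coset K z" if "k \<in> K" "k \<noteq> 0" for k z
  proof
    fix w assume "w \<in> unit_coset K (k * z)"
    then obtain l where "l \<in> K" "l \<noteq> 0" "w = z * (k * l)" by (auto simp: unit_coset_def mult_ac)
    then show "w \<in> unit_coset K z" using that by (auto simp: unit_coset_def)
  qed
  have "unit_coset K (inverse k * (k * z)) \<subseteq> unit_coset K (k * z)"
    by (rule sub) (use assms in auto)
  then show ?thesis using sub[OF assms, of z] assms(2) by (auto simp: mult.assoc[symmetric])
qed

lemma unit_coset_eqD:
  assumes "unit_coset K z = unit_coset K w"
  obtains k where "k \<in> K" "k \<noteq> 0" "z = k * w"
proof -
  have "z * 1 \<in> unit_coset K z" unfolding unit_coset_def by (intro imageI) simp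
  then have "z \<in> unit_coset K w" using assms by simp
  then show ?thesis using that by (auto simp: unit_coset_def mult.commute)
qed

lemma Union_cosets_iff:
  assumes "D \<subseteq> cosets"
  shows "z \<in> \<Union>D \<longleftrightarrow> z \<noteq> 0 \<and> unit_coset K z \<in> D"
proof
  assume "z \<in> \<Union>D"
  then obtain c where c: "c \<noteq> 0" "unit_coset K c \<in> D" "z \<in> unit_coset K c" using assms by blast
  then obtain k where k: "k \<in> K" "k \<noteq> 0" "z = k * c" by (auto simp: unit_coset_def mult.commute)
  then show "z \<noteq> 0 \<and> unit_coset K z \<in> D" using c by (simp add: unit_coset_scale)
next
  assume z: "z \<noteq> 0 \<and> unit_coset K z \<in> D"
  have "z * 1 \<in> unit_coset K z" unfolding unit_coset_def by (intro imageI) simp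
  then show "z \<in> \<Union>D" using z by auto
qed

lemma independentI:
  assumes "v \<noteq> 0" "w \<noteq> 0" "unit_coset K v \<noteq> unit_coset K w" shows "independent v w"
  unfolding independent_def
proof (intro ballI impI)
  fix x y assume xy: "x \<in> K" "y \<in> K" "x * v + y * w = 0"
  have "x = 0"
  proof (rule ccontr)
    assume "x \<noteq> 0"
    moreover have "x * v = (- y) * w" using xy(3) by (simp add: eq_neg_iff_add_eq_0)
    ultimately have v: "v = (- y / x) * w" by (simp add: field_simps)
    then have "- y / x \<noteq> 0" using assms(1) by auto
    then show False using unit_coset_scale[of "- y / x" w] v xy assms(3) by simp
  qed
  then show "x = 0 \<and> y = 0" using xy(3) assms(2) by simp
qed

lemma independent_eqD:
  assumes "independent v w" "x \<in> K" "y \<in> K" "x' \<in> K" "y' \<in> K" "x * v + y * w = x' * v + y' * w"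
  shows "x = x'" "y = y'"
proof -
  have "(x - x') * v + (y - y') * w = 0" using assms(6) by (simp add: algebra_simps)
  then have "x - x' = 0 \<and> y - y' = 0"
    using assms(1)[unfolded independent_def, rule_format, of "x - x'" "y - y'"] assms(2-5) by simp
  then show "x = x'" "y = y'" by simp_all
qed

text \<open>In the new basis slope \<open>s\<close> denotes the old direction
  \<open>a * s + b\<close>, so affine maps of slope sets become changes of basis.\<close>

lemma independent_change:
  assumes "independent v w" "a \<in> K" "a \<noteq> 0" "b \<in> K"
  shows "independent (v + b * w) (a * w)"
  unfolding independent_def
proof (intro ballI impI)
  fix x y assume xy: "x \<in> K" "y \<in> K" "x * (v + b * w) + y * (a * w) = 0"
  then have "x * v + (x * b + y * a) * w = 0 * v + 0 * w" by (simp add: algebra_simps)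
  then have "x = 0" "x * b + y * a = 0"
    using independent_eqD[OF assms(1), of x "x * b + y * a" 0 0] xy assms by auto
  then show "x = 0 \<and> y = 0" using assms(3) by simp
qed

lemma independent_combination_neq_0: "independent v w \<Longrightarrow> s \<in> K \<Longrightarrow> v + s * w \<noteq> 0"
  using independent_eqD(1)[of v w 1 s 0 0] by auto

lemma bij_betw_coordinates:
  assumes "independent v w"
  shows "bij_betw (\<lambda>(x, y). x * v + y * w) (K \<times> K) UNIV"
proof -
  let ?g = "\<lambda>(x, y). x * v + y * w"
  have inj: "inj_on ?g (K \<times> K)"
  proof (rule inj_onI)
    fix z z' assume z: "z \<in> K \<times> K" "z' \<in> K \<times> K" "?g z = ?g z'"
    obtain x y x' y' where xy: "z = (x, y)" "z' = (x', y')" by fastforce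
    then show "z = z'" using z independent_eqD[OF assms, of x y x' y'] by simp
  qed
  then have "card (?g ` (K \<times> K)) = CARD('a)"
    by (simp add: card_image card_cartesian_product card_K card_UNIV power2_eq_square)
  then have "?g ` (K \<times> K) = UNIV" by (intro card_subset_eq) auto
  with inj show ?thesis by (simp add: bij_betw_def)
qed

lemma inj_on_slope_coset:
  assumes "independent v w" shows "inj_on (\<lambda>s. unit_coset K (v + s * w)) K"
proof (rule inj_onI)
  fix s s' assume s: "s \<in> K" "s' \<in> K" "unit_coset K (v + s * w) = unit_coset K (v + s' * w)"
  then obtain k where k: "k \<in> K" "v + s * w = k * (v + s' * w)" by (metis unit_coset_eqD)
  then have "1 * v + s * w = k * v + (k * s') * w" by (simp add: algebra_simps)
  then show "s = s'"
    using independent_eqD[OF assms, of 1 s k "k * s'"] k(1) s by auto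
qed

lemma slope_coset_neq:
  assumes "independent v w" "s \<in> K" shows "unit_coset K (v + s * w) \<noteq> unit_coset K w"
proof
  assume "unit_coset K (v + s * w) = unit_coset K w"
  then obtain k where "k \<in> K" "v + s * w = k * w" by (metis unit_coset_eqD)
  then show False using independent_eqD(1)[OF assms(1), of 1 s 0 k] assms(2) by simp
qed

lemma independent_exists: obtains v w where "independent v w"
proof -
  have "card K < CARD('a)" using card_K_ge_2 p_gt_1 by (simp add: card_K card_UNIV power2_eq_square)
  then have "K \<noteq> UNIV" by auto
  then obtain v where v: "v \<notin> K" by blast
  have "independent v 1"
  proof (rule independentI)
    show "v \<noteq> 0" using v by auto
    show "unit_coset K v \<noteq> unit_coset K 1" using v by (metis unit_coset_eqD mult_1_right)
  qed simp
  then show ?thesis by (rule that)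
qed

lemma independent_neq_0: "independent v w \<Longrightarrow> w \<noteq> 0"
  using independent_eqD(2)[of v w 0 1 0 0] by auto

lemma card_cosets: "p ^ n < card cosets"
proof -
  obtain v w where vw: "independent v w" by (rule independent_exists)
  let ?A = "(\<lambda>s. unit_coset K (v + s * w)) ` K"
  have "card (insert (unit_coset K w) ?A) = Suc (card ?A)"
    using slope_coset_neq[OF vw] by (intro card_insert_disjoint) auto
  also have "card ?A = p ^ n" by (simp add: card_image[OF inj_on_slope_coset[OF vw]] card_K)
  finally have "Suc (p ^ n) = card (insert (unit_coset K w) ?A)" by simp
  also have "\<dots> \<le> card cosets"
    using independent_combination_neq_0[OF vw] independent_neq_0[OF vw] by (intro card_mono) auto
  finally show ?thesis by simp
qed

lemma clique_is_graph:
  assumes D: "coset_family K m D" and C: "is_clique (Cay (\<Union>D)) C" "card C = card K"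
  obtains v w f where "independent v w" "f ` K \<subseteq> K" "C = (\<lambda>x. x * v + f x * w) ` K"
    "\<And>s. s \<in> slopes K f \<Longrightarrow> unit_coset K (v + s * w) \<in> D"
proof -
  have D_sub: "D \<subseteq> cosets" and D_card: "card D \<le> p ^ n"
    using D by (auto simp: coset_family_def card_K)
  have C_diff: "unit_coset K (u - u') \<in> D" if "u \<in> C" "u' \<in> C" "u \<noteq> u'" for u u'
  proof -
    have "u - u' \<in> \<Union>D" using C(1) that unfolding is_clique_Cay by blast
    then show ?thesis unfolding Union_cosets_iff[OF D_sub] by simp
  qed
  have "\<not> cosets \<subseteq> D" using card_mono[of D cosets] card_cosets D_card by auto
  then obtain w where w: "w \<noteq> 0" "unit_coset K w \<notin> D" by blast
  have "\<not> cosets \<subseteq> {unit_coset K w}"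
    using card_mono[of "{unit_coset K w}" cosets] card_cosets card_K_ge_2 by auto
  then obtain v where v: "v \<noteq> 0" "unit_coset K v \<noteq> unit_coset K w" by blast
  have vw: "independent v w" by (rule independentI) (use v w in auto)
  let ?g = "\<lambda>(x, y). x * v + y * w"
  have bij: "bij_betw ?g (K \<times> K) UNIV" by (rule bij_betw_coordinates[OF vw])
  define X Y where "X = fst \<circ> inv_into (K \<times> K) ?g" and "Y = snd \<circ> inv_into (K \<times> K) ?g"
  have XY: "X u \<in> K" "Y u \<in> K" "X u * v + Y u * w = u" for u
  proof -
    have "inv_into (K \<times> K) ?g u \<in> K \<times> K"
      using bij_betw_imp_surj_on[OF bij] by (intro inv_into_into) simp
    then show "X u \<in> K" "Y u \<in> K" by (auto simp: X_def Y_def mem_Times_iff)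
    have "?g (inv_into (K \<times> K) ?g u) = u" by (rule bij_betw_inv_into_right[OF bij]) simp
    then show "X u * v + Y u * w = u" by (simp add: X_def Y_def case_prod_beta)
  qed
  have inj: "inj_on X C"
  proof (rule inj_onI, rule ccontr)
    fix u u' assume u: "u \<in> C" "u' \<in> C" "X u = X u'" "u \<noteq> u'"
    have "u - u' = (X u * v + Y u * w) - (X u' * v + Y u' * w)" by (simp only: XY(3))
    also have "\<dots> = (Y u - Y u') * w" using u(3) by (simp add: algebra_simps)
    finally have eq: "u - u' = (Y u - Y u') * w" .
    then have "Y u - Y u' \<noteq> 0" using u(4) by auto
    then have "unit_coset K (u - u') = unit_coset K w" unfolding eq by (intro unit_coset_scale) (simp_all add: XY)
    then show False using C_diff[OF u(1,2,4)] w(2) by simp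
  qed
  have X_image: "X ` C = K"
    using XY by (intro card_subset_eq) (auto simp: card_image[OF inj] C(2))
  define f where "f = Y \<circ> inv_into C X"
  have point: "inv_into C X x \<in> C" "inv_into C X x = x * v + f x * w" if "x \<in> K" for x
  proof -
    show "inv_into C X x \<in> C" using that X_image by (simp add: inv_into_into)
    have "X (inv_into C X x) = x" using that X_image by (simp add: f_inv_into_f)
    then show "inv_into C X x = x * v + f x * w" using XY(3)[of "inv_into C X x", symmetric] by (simp add: f_def)
  qed
  show ?thesis
  proof (rule that[OF vw, of f])
    show "f ` K \<subseteq> K" using XY by (auto simp: f_def)
    have "C = inv_into C X ` K"
      using inv_into_image_cancel[OF inj, of C] X_image by simp
    also have "\<dots> = (\<lambda>x. x * v + f x * w) ` K" by (intro image_cong refl point(2))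
    finally show "C = (\<lambda>x. x * v + f x * w) ` K" .
    fix s assume "s \<in> slopes K f"
    then obtain x y where xy: "x \<in> K" "y \<in> K" "x \<noteq> y" "s = (f x - f y) / (x - y)"
      by (auto simp: slopes_def)
    then have s: "(x - y) * s = f x - f y" by simp
    let ?u = "inv_into C X x" and ?u' = "inv_into C X y"
    have "?u \<noteq> ?u'"
    proof
      assume "?u = ?u'"
      then have "x = y" by (rule inv_into_injective) (use X_image xy in simp_all)
      then show False using xy(3) by simp
    qed
    then have "unit_coset K (?u - ?u') \<in> D" using point(1) xy by (intro C_diff) auto
    moreover have "?u - ?u' = (x - y) * (v + s * w)"
    proof -
      have "?u - ?u' = (x - y) * v + (f x - f y) * w"
        using point(2)[OF xy(1)] point(2)[OF xy(2)] by (simp add: algebra_simps)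
      then show ?thesis unfolding s[symmetric] by (simp add: algebra_simps)
    qed
    ultimately show "unit_coset K (v + s * w) \<in> D" using xy by (simp add: unit_coset_scale)
  qed
qed

text \<open>If \<open>f\<close> were affine with slope \<open>a\<close>, the clique would be
  canonical in direction \<open>v + a * w\<close>.\<close>

lemma not_strict_EKR_imp_function:
  assumes D: "coset_family K m D" and "\<not> strict_EKR K D"
  obtains v w f where "independent v w" "f ` K \<subseteq> K" "\<not> affine_fun K f"
    "(\<lambda>s. unit_coset K (v + s * w)) ` slopes K f \<subseteq> D"
proof -
  obtain C where C: "is_clique (Cay (\<Union>D)) C" "card C = card K" "\<not> canonical_clique K D C"
    using assms(2) by (auto simp: strict_EKR_def)
  obtain v w f where f: "independent v w" "f ` K \<subseteq> K" "C = (\<lambda>x. x * v + f x * w) ` K"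
    "\<And>s. s \<in> slopes K f \<Longrightarrow> unit_coset K (v + s * w) \<in> D"
    by (rule clique_is_graph[OF D C(1,2)], rule that)
  have "\<not> affine_fun K f"
  proof
    assume "affine_fun K f"
    then obtain a b where ab: "\<And>x. x \<in> K \<Longrightarrow> f x = a * x + b" by (auto simp: affine_fun_def)
    have a: "a = (f 1 - f 0) / (1 - 0)" by (simp add: ab)
    then have "a \<in> slopes K f" using slopesI[of 1 K 0 f] by simp
    then have "unit_coset K (v + a * w) \<in> D" and "a \<in> K"
      using f(4) slopes_subset[OF f(2)] by auto
    moreover have "C = (\<lambda>k. b * w + (v + a * w) * k) ` K"
      unfolding f(3) by (intro image_cong refl) (simp add: ab algebra_simps)
    ultimately have "canonical_clique K D C"
      using independent_combination_neq_0[OF f(1)] unfolding canonical_clique_def by blast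
    then show False using C(3) by simp
  qed
  then show ?thesis using that[OF f(1,2)] f(4) by blast
qed

text \<open>The graph of \<open>f\<close> is a clique of size \<open>q\<close>; if it were
  canonical, comparing coordinates would exhibit it as a line that is not parallel to
  \<open>w\<close>, making \<open>f\<close> affine.\<close>

lemma function_imp_not_strict_EKR:
  assumes vw: "independent v w" and f: "f ` K \<subseteq> K" "\<not> affine_fun K f"
    and D: "D \<subseteq> cosets" "(\<lambda>s. unit_coset K (v + s * w)) ` slopes K f \<subseteq> D"
  shows "\<not> strict_EKR K D"
proof
  assume EKR: "strict_EKR K D"
  define C where "C = (\<lambda>x. x * v + f x * w) ` K"
  have fK: "f x \<in> K" if "x \<in> K" for x using f(1) that by auto
  have inj: "inj_on (\<lambda>x. x * v + f x * w) K"
    using independent_eqD(1)[OF vw _ fK _ fK] by (intro inj_onI)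
  have "is_clique (Cay (\<Union>D)) C"
    unfolding is_clique_Cay
  proof (intro ballI impI)
    fix u u' assume u: "u \<in> C" "u' \<in> C" "u \<noteq> u'"
    then obtain x y where xy: "x \<in> K" "y \<in> K" "x \<noteq> y" "u = x * v + f x * w" "u' = y * v + f y * w"
      unfolding C_def by blast
    define s where "s = (f x - f y) / (x - y)"
    have s: "s \<in> slopes K f" unfolding s_def by (rule slopesI[OF xy(1-3)])
    have "(x - y) * s = f x - f y" using xy(3) by (simp add: s_def)
    moreover have "u - u' = (x - y) * v + (f x - f y) * w" by (simp add: xy algebra_simps)
    ultimately have "u - u' = (x - y) * (v + s * w)" by (metis distrib_left mult.assoc)
    then have "unit_coset K (u - u') = unit_coset K (v + s * w)"
      using xy by (simp add: unit_coset_scale)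
    then have "unit_coset K (u - u') \<in> D" using s D(2) by auto
    then show "u - u' \<in> \<Union>D" using u(3) by (subst Union_cosets_iff[OF D(1)]) simp
  qed
  moreover have "card C = card K" unfolding C_def by (rule card_image[OF inj])
  ultimately obtain u c where c: "c \<noteq> 0" "C = (\<lambda>k. u + c * k) ` K"
    using EKR unfolding strict_EKR_def canonical_clique_def by blast
  have surj: "\<exists>x y. x \<in> K \<and> y \<in> K \<and> z = x * v + y * w" for z
    using bij_betw_imp_surj_on[OF bij_betw_coordinates[OF vw]] by (force simp: image_iff set_eq_iff)
  obtain u1 u2 where u: "u1 \<in> K" "u2 \<in> K" "u = u1 * v + u2 * w" using surj by blast
  obtain c1 c2 where c': "c1 \<in> K" "c2 \<in> K" "c = c1 * v + c2 * w" using surj by blast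
  have param: "\<exists>k\<in>K. x = u1 + c1 * k \<and> f x = u2 + c2 * k" if "x \<in> K" for x
  proof -
    have "x * v + f x * w \<in> C" using that by (simp add: C_def)
    then obtain k where k: "k \<in> K" "x * v + f x * w = u + c * k" unfolding c(2) by blast
    then have eq: "x * v + f x * w = (u1 + c1 * k) * v + (u2 + c2 * k) * w"
      by (simp add: u c' algebra_simps)
    have "x = u1 + c1 * k" "f x = u2 + c2 * k"
      using independent_eqD[OF vw that fK[OF that] _ _ eq] u c' k(1) by simp_all
    then show ?thesis using k(1) by blast
  qed
  \<comment> \<open>Both 0 and 1 occur as first coordinates, which are all equal to
    \<open>u1\<close> if \<open>c1 = 0\<close>.\<close>
  have "c1 \<noteq> 0" using param[of 0] param[of 1] by auto
  have "f x = (c2 / c1) * x + (u2 - c2 / c1 * u1)" if x: "x \<in> K" for x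
  proof -
    obtain k where k: "x = u1 + c1 * k" "f x = u2 + c2 * k" using param[OF x] by blast
    show ?thesis unfolding k(2) using \<open>c1 \<noteq> 0\<close> by (simp add: k(1) field_simps)
  qed
  then show False using f(2) unfolding affine_fun_def by blast
qed

section \<open>From slope counts to extremal graphs\<close>

text \<open>Distinct slopes give distinct cosets of \<open>D\<close>, whence
  \<open>N \<le> m\<close>. If \<open>m > N\<close>, the slope cosets of the example extend to
  \<open>m - 1\<close> cosets without strict EKR, against minimality.\<close>

lemma extremal_card:
  assumes lower: "\<And>f. f ` K \<subseteq> K \<Longrightarrow> \<not> affine_fun K f \<Longrightarrow> N \<le> card (slopes K f)"
    and ex: "f ` K \<subseteq> K" "\<not> affine_fun K f" "card (slopes K f) \<le> N"
    and D: "coset_family K m D" "\<not> strict_EKR K D"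
    and min: "\<And>D'. coset_family K (m - 1) D' \<Longrightarrow> strict_EKR K D'"
  shows "m = N"
proof (rule antisym)
  have D': "card D = m" "m \<le> p ^ n" "finite D" using D(1) by (auto simp: coset_family_def card_K)
  obtain v w g where g: "independent v w" "g ` K \<subseteq> K" "\<not> affine_fun K g"
    "(\<lambda>s. unit_coset K (v + s * w)) ` slopes K g \<subseteq> D"
    by (rule not_strict_EKR_imp_function[OF D], rule that)
  have inj: "inj_on (\<lambda>s. unit_coset K (v + s * w)) (slopes K h)" if "h ` K \<subseteq> K" for h
    using inj_on_slope_coset[OF g(1)] slopes_subset[OF that] by (rule inj_on_subset)
  have "N \<le> card (slopes K g)" by (rule lower[OF g(2,3)])
  also have "\<dots> \<le> card D"
    using card_mono[OF \<open>finite D\<close> g(4)] card_image[OF inj[OF g(2)]] by simp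
  finally show "N \<le> m" using D' by simp
  show "m \<le> N"
  proof (rule ccontr)
    assume "\<not> m \<le> N"
    let ?S = "(\<lambda>s. unit_coset K (v + s * w)) ` slopes K f"
    have "card ?S \<le> m - 1" using card_image[OF inj[OF ex(1)]] ex(3) \<open>\<not> m \<le> N\<close> by simp
    moreover have "m - 1 \<le> card cosets" using card_cosets D'(2) by simp
    moreover have S_sub: "?S \<subseteq> cosets"
      using independent_combination_neq_0[OF g(1)] slopes_subset[OF ex(1)] by auto
    ultimately obtain E where E: "?S \<subseteq> E" "E \<subseteq> cosets" "card E = m - 1"
      using exists_subset_between[of ?S "m - 1" cosets] by auto
    have "(f 0 - f 1) / (0 - 1) \<in> slopes K f" by (rule slopesI) auto
    then have "card (slopes K f) > 0" by (auto simp: card_gt_0_iff)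
    then have "1 \<le> m - 1" using ex(3) \<open>\<not> m \<le> N\<close> by simp
    then have "coset_family K (m - 1) E"
      using E D'(2) by (simp add: coset_family_def card_K)
    then show False
      using min function_imp_not_strict_EKR[OF g(1) ex(1,2) E(2,1)] by blast
  qed
qed

text \<open>In either basis adjacency says that the coordinate difference \<open>(x, y)\<close> has
  \<open>x \<noteq> 0\<close> and \<open>y / x \<in> S\<close>, so the linear map between the bases
  is an isomorphism.\<close>

lemma peisert_iso:
  assumes vw: "independent v w" and vw': "independent v' w'" and S: "S \<subseteq> K"
  defines "D \<equiv> (\<lambda>s. unit_coset K (v + s * w)) ` S" and "D' \<equiv> (\<lambda>s. unit_coset K (v' + s * w')) ` S"
  shows "digraph_iso (Cay (\<Union>D)) (Cay (\<Union>D'))"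
proof -
  have mem: "x * v + y * w \<in> \<Union>((\<lambda>s. unit_coset K (v + s * w)) ` S) \<longleftrightarrow> x \<noteq> 0 \<and> y / x \<in> S"
    if vw: "independent v w" and xy: "x \<in> K" "y \<in> K" for v w x y
  proof
    assume "x * v + y * w \<in> \<Union>((\<lambda>s. unit_coset K (v + s * w)) ` S)"
    then obtain s k where sk: "s \<in> S" "k \<in> K" "k \<noteq> 0" "x * v + y * w = (v + s * w) * k"
      by (auto simp: unit_coset_def)
    then have "x * v + y * w = k * v + (k * s) * w" by (simp add: algebra_simps)
    then have "x = k" "y = k * s" using independent_eqD[OF vw xy, of k "k * s"] sk S by auto
    then show "x \<noteq> 0 \<and> y / x \<in> S" using sk by simp
  next
    assume x: "x \<noteq> 0 \<and> y / x \<in> S"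
    then have "x * v + y * w = (v + (y / x) * w) * x" by (simp add: field_simps)
    then have "x * v + y * w \<in> unit_coset K (v + (y / x) * w)"
      using x xy by (auto simp: unit_coset_def)
    then show "x * v + y * w \<in> \<Union>((\<lambda>s. unit_coset K (v + s * w)) ` S)" using x by blast
  qed
  let ?g = "\<lambda>(x, y). x * v + y * w" and ?g' = "\<lambda>(x, y). x * v' + y * w'"
  have bij: "bij_betw ?g (K \<times> K) UNIV" and bij': "bij_betw ?g' (K \<times> K) UNIV"
    using bij_betw_coordinates vw vw' by auto
  define \<phi> where "\<phi> = ?g' \<circ> inv_into (K \<times> K) ?g"
  show ?thesis
  proof (rule digraph_iso_Cay)
    show "bij \<phi>" unfolding \<phi>_def by (rule bij_betw_trans[OF bij_betw_inv_into[OF bij] bij'])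
    have \<phi>: "\<phi> (x * v + y * w) = x * v' + y * w'" if "x \<in> K" "y \<in> K" for x y
      using bij_betw_inv_into_left[OF bij, of "(x, y)"] that by (simp add: \<phi>_def)
    have surj: "\<exists>x y. x \<in> K \<and> y \<in> K \<and> z = x * v + y * w" for z
      using bij_betw_imp_surj_on[OF bij] by (force simp: image_iff set_eq_iff)
    fix u u'
    obtain x y where xy: "x \<in> K" "y \<in> K" "u = x * v + y * w" using surj by blast
    obtain x' y' where xy': "x' \<in> K" "y' \<in> K" "u' = x' * v + y' * w" using surj by blast
    have "u - u' = (x - x') * v + (y - y') * w" by (simp add: xy xy' algebra_simps)
    moreover have "\<phi> u - \<phi> u' = (x - x') * v' + (y - y') * w'"
    proof -
      have "\<phi> u = x * v' + y * w'" "\<phi> u' = x' * v' + y' * w'"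
        unfolding xy(3) xy'(3) by (simp_all add: \<phi> xy xy')
      then show ?thesis by (simp add: algebra_simps)
    qed
    ultimately show "u - u' \<in> \<Union>D \<longleftrightarrow> \<phi> u - \<phi> u' \<in> \<Union>D'"
      using mem[OF vw, of "x - x'" "y - y'"] mem[OF vw', of "x - x'" "y - y'"] xy xy'
      by (simp add: D_def D'_def)
  qed
qed

text \<open>Equality in the slope bound leaves no further coset in \<open>D\<close> and fixes the
  slope set up to an affine map, which is absorbed into the basis.\<close>

lemma extremal_prime_cosets:
  assumes n: "n = 1" and "odd p" and D: "coset_family K ((p + 3) div 2) D" "\<not> strict_EKR K D"
  obtains v w where "independent v w"
    "D = (\<lambda>s. unit_coset K (v + s * w)) ` slopes K (\<lambda>x. x ^ ((p + 1) div 2))"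
proof -
  have even: "2 * ((p + 3) div 2) = p + 3" using \<open>odd p\<close> by simp
  have D': "card D = (p + 3) div 2" "finite D" using D(1) by (auto simp: coset_family_def)
  obtain v w g where g: "independent v w" "g ` K \<subseteq> K" "\<not> affine_fun K g"
    "(\<lambda>s. unit_coset K (v + s * w)) ` slopes K g \<subseteq> D"
    by (rule not_strict_EKR_imp_function[OF D], rule that)
  have inj: "inj_on (\<lambda>s. unit_coset K (v + s * w)) (slopes K g)"
    using inj_on_slope_coset[OF g(1)] slopes_subset[OF g(2)] by (rule inj_on_subset)
  have "card (slopes K g) \<le> card D"
    using card_mono[OF D'(2) g(4)] card_image[OF inj] by simp
  moreover have "p + 3 \<le> 2 * card (slopes K g)"
    by (rule card_slopes_prime[OF g(2,3) n \<open>odd p\<close>])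
  ultimately have N: "2 * card (slopes K g) = p + 3" and eq: "card (slopes K g) = card D"
    using D'(1) even by linarith+
  have D_eq: "D = (\<lambda>s. unit_coset K (v + s * w)) ` slopes K g"
    using card_subset_eq[OF D'(2) g(4)] card_image[OF inj] eq by simp
  obtain c b where cb: "c \<in> K" "c \<noteq> 0" "b \<in> K"
    "slopes K g = (\<lambda>s. c * s + b) ` slopes K (\<lambda>x. x ^ ((p + 1) div 2))"
    by (rule slopes_extremal_prime[OF g(2,3) n \<open>odd p\<close> N])
  show ?thesis
  proof (rule that)
    show "independent (v + b * w) (c * w)" by (rule independent_change[OF g(1) cb(1-3)])
    show "D = (\<lambda>s. unit_coset K (v + b * w + s * (c * w))) ` slopes K (\<lambda>x. x ^ ((p + 1) div 2))"
      unfolding D_eq cb(4) image_image by (intro image_cong refl) (simp add: algebra_simps)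
  qed
qed

end

section \<open>Types of extremal graphs, and uniqueness over prime fields\<close>

theorem theorem1p3:
  fixes p n q :: nat
    and K :: "'a::{field,finite} set"
    and X :: "('a, 'a \<times> 'a) pre_digraph"
  assumes "prime p" and "n > 0" and "q = p ^ n"
    and "CARD('a) = q ^ 2"
    and "is_subfield K" and "card K = q"
    and "extremal_peisert K X"
  shows "(n = 1 \<and> p \<ge> 3 \<longrightarrow>
            peisert_type K ((p + 3) div 2) X \<and>
            (\<forall>Y. extremal_peisert K Y \<longrightarrow> digraph_iso X Y)) \<and>
         (n > 1 \<longrightarrow>
            peisert_type K (p ^ (n - Max {k. k dvd n \<and> k < n}) + 1) X)"
proof -
  have "CHAR('a) = p"
  proof -
    \<comment> \<open>Translating by 1 does not change the sum of all elements, so the order of the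
      field is 0 in it and the characteristic divides a power of \<open>p\<close>.\<close>
    have "(\<Sum>x\<in>UNIV. x) = (\<Sum>x\<in>UNIV. x + (1 :: 'a))"
      by (rule sum.reindex_bij_witness[of _ "\<lambda>x. x + 1" "\<lambda>x. x - 1"]) auto
    then have "of_nat (CARD('a)) = (0 :: 'a)" by (simp add: sum.distrib)
    then have "CHAR('a) dvd q ^ 2" using assms(4) of_nat_eq_0_iff_char_dvd by metis
    then have "CHAR('a) dvd p ^ (n * 2)" using assms(3) by (simp add: power_mult)
    moreover have "prime CHAR('a)"
      by (intro prime_CHAR_semidom finite_imp_CHAR_pos) simp
    ultimately show ?thesis using assms(1) by (metis prime_dvd_power primes_dvd_imp_eq)
  qed
  then interpret quadratic_extension K p n
    using assms by unfold_locales simp_all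
  have extremal: "\<exists>D. coset_family K N D \<and> Y = Cay (\<Union>D) \<and> \<not> strict_EKR K D"
    if "extremal_peisert K Y" and lower: "\<And>f. f ` K \<subseteq> K \<Longrightarrow> \<not> affine_fun K f \<Longrightarrow> N \<le> card (slopes K f)"
      and ex: "f ` K \<subseteq> K" "\<not> affine_fun K f" "card (slopes K f) \<le> N" for Y N f
  proof -
    obtain m D where D: "coset_family K m D" "Y = Cay (\<Union>D)" "\<not> strict_EKR K D"
      and min: "\<forall>D'. coset_family K (m - 1) D' \<longrightarrow> strict_EKR K D'"
      using \<open>extremal_peisert K Y\<close> unfolding extremal_peisert_def by blast
    have "m = N" by (rule extremal_card[OF lower ex D(1,3)]) (use min in auto)
    then show ?thesis using D by blast
  qed
  have part1: "peisert_type K ((p + 3) div 2) X \<and> (\<forall>Y. extremal_peisert K Y \<longrightarrow> digraph_iso X Y)"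
    if n: "n = 1" and p: "p \<ge> 3"
  proof -
    have "odd p" using assms(1) p prime_odd_nat by auto
    let ?f = "\<lambda>x :: 'a. x ^ ((p + 1) div 2)"
    have lower: "(p + 3) div 2 \<le> card (slopes K f)" if "f ` K \<subseteq> K" "\<not> affine_fun K f" for f
      using card_slopes_prime[OF that n \<open>odd p\<close>] by linarith
    have ext: "\<exists>D. coset_family K ((p + 3) div 2) D \<and> Y = Cay (\<Union>D) \<and> \<not> strict_EKR K D"
      if "extremal_peisert K Y" for Y
      by (rule extremal[OF that lower power_example[OF n \<open>odd p\<close>]])
    obtain D where D: "coset_family K ((p + 3) div 2) D" "X = Cay (\<Union>D)" "\<not> strict_EKR K D"
      using ext[OF assms(7)] by blast
    obtain v w where vw: "independent v w" "D = (\<lambda>s. unit_coset K (v + s * w)) ` slopes K ?f"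
      by (rule extremal_prime_cosets[OF n \<open>odd p\<close> D(1,3)])
    have "digraph_iso X Y" if Y: "extremal_peisert K Y" for Y
    proof -
      obtain D' where D': "coset_family K ((p + 3) div 2) D'" "Y = Cay (\<Union>D')" "\<not> strict_EKR K D'"
        using ext[OF Y] by blast
      obtain v' w' where vw': "independent v' w'" "D' = (\<lambda>s. unit_coset K (v' + s * w')) ` slopes K ?f"
        by (rule extremal_prime_cosets[OF n \<open>odd p\<close> D'(1,3)])
      have "slopes K ?f \<subseteq> K" by (rule slopes_subset) auto
      then show ?thesis
        unfolding D(2) D'(2) vw(2) vw'(2) by (rule peisert_iso[OF vw(1) vw'(1)])
    qed
    then show ?thesis using D unfolding peisert_type_def by blast
  qed
  have part2: "peisert_type K (p ^ (n - Max {k. k dvd n \<and> k < n}) + 1) X" if n: "n > 1"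
  proof -
    define k where "k = Max {k. k dvd n \<and> k < n}"
    have "k \<in> {k. k dvd n \<and> k < n}" unfolding k_def using n by (intro Max_in) auto
    then have k: "k dvd n" "k < n" by auto
    have "\<exists>D. coset_family K (p ^ (n - k) + 1) D \<and> X = Cay (\<Union>D) \<and> \<not> strict_EKR K D"
      unfolding k_def
      by (rule extremal[OF assms(7) card_slopes_composite trace_example[OF k, unfolded k_def]]) (use n in auto)
    then show ?thesis unfolding peisert_type_def k_def by blast
  qed
  show ?thesis using part1 part2 by blast
qed

end
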